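(* Let $(G,\le)$ be a totally ordered set, let $\Gamma=\{(\mathcal{T}_k,\mathcal{F}_k)\}_{k\in G}$ be a nested family of torsion pairs in an abelian length category $\mathcal{A}$ (as in the context), and let $M_\bullet=(M_k)_{k\in G}$ be an object of $\mathrm{Gr}_G(\mathcal{A})$. 1. If $M_\bullet\in\mathcal{M}^{\dagger}(\Gamma)$, then $M_\bullet$ induces the pre-stratifying system $\Omega=\{\mathfrak{F}_k(M_\bullet)\}_{k\in G}$ as a quotient; that is, $\{\mathfrak{F}_k(M_\bullet)\}_{k\in G}$ is a pre-stratifying system. 2. If $M_\bullet\in\mathcal{N}^{\dagger}(\Gamma)$, then $M_\bullet$ induces the pre-stratifying system $\Omega=\{\mathfrak{T}_k(M_\bullet)\}_{k\in G}$ as a subobject; that is, $\{\mathfrak{T}_k(M_\bullet)\}_{k\in G}$ is a pre-stratifying system.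
   Context: Throughout, $\mathcal{A}$ is a $k$-linear, Hom-finite, skeletally small abelian category over an algebraically closed field $k$, in which every object has finite length. For a class $\mathcal{C}$, $\mathcal{C}^{\bot}=\{M\mid \mathrm{Hom}_{\mathcal{A}}(C,M)=0\ \forall C\in\mathcal{C}\}$ and ${}^{\bot}\mathcal{C}=\{M\mid \mathrm{Hom}_{\mathcal{A}}(M,C)=0\ \forall C\in\mathcal{C}\}$. A torsion pair $(\mathcal{T},\mathcal{F})$ is a pair of full subcategories with no non-zero morphisms from $\mathcal{T}$ to $\mathcal{F}$ such that each $M\in\mathcal{A}$ admits a (unique up to isomorphism) short exact sequence $0\to t(M)\to M\to f(M)\to0$ with $t(M)\in\mathcal{T}$ (the torsion part) and $f(M)\in\mathcal{F}$ (the torsion-free part). A nested family of torsion pairs indexed by $G$ is a family $\{(\mathcal{T}_k,\mathcal{F}_k)\}_{k\in G}$ of torsion pairs with $\mathcal{T}_k\supsetneq\mathcal{T}_l$ whenever $k<l$ (equivalently $\mathcal{F}_k\subsetneq\mathcal{F}_l$). A pre-stratifying system indexed by $G$ is a family $\{\Omega_k\}_{k\in G}$ of non-zero objects with $\mathrm{Hom}_{\mathcal{A}}(\Omega_k,\Omega_j)=0$ whenever $k>j$ and $\mathrm{Ext}^1_{\mathcal{A}}(\Omega_k,\Omega_j)=0$ whenever $k\ge j$. $\mathrm{Gr}_G(\mathcal{A})$ is the category of families $(M_k)_{k\in G}$ of objects of $\mathcal{A}$ with componentwise morphisms; $0_\bullet=(0)_{k\in G}$. $\mathcal{M}(\Gamma)$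 is the full subcategory consisting of $0_\bullet$ and the $(M_k)$ such that for all $k$: $M_k\ne0$, $M_k\in\mathcal{T}_k$, and $M_k\notin\mathcal{T}_j$ whenever $j>k$. $\mathcal{N}(\Gamma)$ consists of $0_\bullet$ and the $(N_k)$ such that for all $k$: $N_k\ne0$, $N_k\in\mathcal{F}_k$, and $N_k\notin\mathcal{F}_j$ whenever $j<k$. For $M_\bullet\in\mathcal{M}(\Gamma)$, $\mathfrak{F}_k(M_\bullet)$ is the torsion-free part of $M_k$ with respect to the torsion pair $({}^{\bot}(\bigcap_{j>k}\mathcal{F}_j),\ \bigcap_{j>k}\mathcal{F}_j)$, where $\bigcap_{j>k}\mathcal{F}_j:=\mathcal{A}$ if $k$ is the maximum of $G$. For $N_\bullet\in\mathcal{N}(\Gamma)$, $\mathfrak{T}_k(N_\bullet)$ is the torsion part of $N_k$ with respect to the torsion pair $(\bigcap_{j<k}\mathcal{T}_j,\ (\bigcap_{j<k}\mathcal{T}_j)^{\bot})$, where $\bigcap_{j<k}\mathcal{T}_j:=\mathcal{A}$ if $k$ is the minimum of $G$. $\mathcal{M}^{\dagger}(\Gamma)$ is the full subcategory of $\mathcal{M}(\Gamma)$ of all non-zero $M_\bullet$ with $\mathrm{Ext}^1_{\mathcal{A}}(M_k,\mathfrak{F}_j(M_\bullet))=0$ for all $k\ge j$. $\mathcal{N}^{\dagger}(\Gamma)$ is the full subcategory of $\mathcal{N}(\Gamma)$ of all non-zero $N_\bullet$ with $\mathrm{Ext}^1_{\mathcal{A}}(\mathfrak{T}_k(N_\bullet),N_j)=0$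 for all $k\ge j$. *)

theory Defs
  imports "HOL-Algebra.Algebra"
begin

no_notation var (\<open>X\<index>\<close>)  (* frees X as a variable name *)

section \<open>Linear categories\<close>

text \<open>
  A category enriched in modules: every hom-set is a HOL-Algebra module. Only the additive part and
  the scalar multiplication of the module record are used; its ring multiplication and unit
  fields are irrelevant (the locale \<^locale>\<open>module\<close> does not mention them).
  Hom-sets of different pairs of objects need not be disjoint; therefore all notions below carry the
  source and target objects of the morphisms explicitly.
\<close>

record ('o, 'm, 'k) lin_cat =
  Obj  :: "'o set"
  Hom  :: "'o \<Rightarrow> 'o \<Rightarrow> ('k, 'm) module"
  Ident :: "'o \<Rightarrow> 'm"
  Comp :: "'m \<Rightarrow> 'm \<Rightarrow> 'm"  (infixl \<open>\<cdot>\<index>\<close> 70)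

abbreviation arr :: "('o, 'm, 'k, 'x) lin_cat_scheme \<Rightarrow> 'o \<Rightarrow> 'o \<Rightarrow> 'm set" where
  "arr C X Y \<equiv> carrier (Hom C X Y)"

abbreviation zero_arr :: "('o, 'm, 'k, 'x) lin_cat_scheme \<Rightarrow> 'o \<Rightarrow> 'o \<Rightarrow> 'm" where
  "zero_arr C X Y \<equiv> \<zero>\<^bsub>Hom C X Y\<^esub>"

text \<open>\<open>g \<cdot>\<^bsub>C\<^esub> f\<close> is ``first f, then g''.\<close>

locale linear_category = R?: field K
  for K :: "('k, 'r) ring_scheme" (structure)
    and C :: "('o, 'm, 'k, 'x) lin_cat_scheme" +
  assumes Hom_module: "\<lbrakk>X \<in> Obj C; Y \<in> Obj C\<rbrakk> \<Longrightarrow> module K (Hom C X Y)"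
    and Ident_arr: "X \<in> Obj C \<Longrightarrow> Ident C X \<in> arr C X X"
    and Comp_arr: "\<lbrakk>X \<in> Obj C; Y \<in> Obj C; Z \<in> Obj C; f \<in> arr C X Y; g \<in> arr C Y Z\<rbrakk>
        \<Longrightarrow> g \<cdot>\<^bsub>C\<^esub> f \<in> arr C X Z"
    and Comp_Ident_right: "\<lbrakk>X \<in> Obj C; Y \<in> Obj C; f \<in> arr C X Y\<rbrakk> \<Longrightarrow> f \<cdot>\<^bsub>C\<^esub> Ident C X = f"
    and Comp_Ident_left: "\<lbrakk>X \<in> Obj C; Y \<in> Obj C; f \<in> arr C X Y\<rbrakk> \<Longrightarrow> Ident C Y \<cdot>\<^bsub>C\<^esub> f = f"
    and Comp_assoc: "\<lbrakk>W \<in> Obj C; X \<in> Obj C; Y \<in> Obj C; Z \<in> Obj C;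
          f \<in> arr C W X; g \<in> arr C X Y; h \<in> arr C Y Z\<rbrakk>
        \<Longrightarrow> (h \<cdot>\<^bsub>C\<^esub> g) \<cdot>\<^bsub>C\<^esub> f = h \<cdot>\<^bsub>C\<^esub> (g \<cdot>\<^bsub>C\<^esub> f)"
    and Comp_add_right: "\<lbrakk>X \<in> Obj C; Y \<in> Obj C; Z \<in> Obj C;
          f \<in> arr C X Y; f' \<in> arr C X Y; g \<in> arr C Y Z\<rbrakk>
        \<Longrightarrow> g \<cdot>\<^bsub>C\<^esub> (f \<oplus>\<^bsub>Hom C X Y\<^esub> f') = (g \<cdot>\<^bsub>C\<^esub> f) \<oplus>\<^bsub>Hom C X Z\<^esub> (g \<cdot>\<^bsub>C\<^esub> f')"
    and Comp_add_left: "\<lbrakk>X \<in> Obj C; Y \<in> Obj C; Z \<in> Obj C;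
          f \<in> arr C X Y; g \<in> arr C Y Z; g' \<in> arr C Y Z\<rbrakk>
        \<Longrightarrow> (g \<oplus>\<^bsub>Hom C Y Z\<^esub> g') \<cdot>\<^bsub>C\<^esub> f = (g \<cdot>\<^bsub>C\<^esub> f) \<oplus>\<^bsub>Hom C X Z\<^esub> (g' \<cdot>\<^bsub>C\<^esub> f)"
    and Comp_smult_right: "\<lbrakk>X \<in> Obj C; Y \<in> Obj C; Z \<in> Obj C;
          a \<in> carrier K; f \<in> arr C X Y; g \<in> arr C Y Z\<rbrakk>
        \<Longrightarrow> g \<cdot>\<^bsub>C\<^esub> (a \<odot>\<^bsub>Hom C X Y\<^esub> f) = a \<odot>\<^bsub>Hom C X Z\<^esub> (g \<cdot>\<^bsub>C\<^esub> f)"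
    and Comp_smult_left: "\<lbrakk>X \<in> Obj C; Y \<in> Obj C; Z \<in> Obj C;
          a \<in> carrier K; f \<in> arr C X Y; g \<in> arr C Y Z\<rbrakk>
        \<Longrightarrow> (a \<odot>\<^bsub>Hom C Y Z\<^esub> g) \<cdot>\<^bsub>C\<^esub> f = a \<odot>\<^bsub>Hom C X Z\<^esub> (g \<cdot>\<^bsub>C\<^esub> f)"

definition is_iso :: "('o, 'm, 'k, 'x) lin_cat_scheme \<Rightarrow> 'o \<Rightarrow> 'o \<Rightarrow> 'm \<Rightarrow> bool" where
  "is_iso C X Y f \<longleftrightarrow> X \<in> Obj C \<and> Y \<in> Obj C \<and> f \<in> arr C X Y \<and>
     (\<exists>g \<in> arr C Y X. g \<cdot>\<^bsub>C\<^esub> f = Ident C X \<and> f \<cdot>\<^bsub>C\<^esub> g = Ident C Y)"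

definition is_mono :: "('o, 'm, 'k, 'x) lin_cat_scheme \<Rightarrow> 'o \<Rightarrow> 'o \<Rightarrow> 'm \<Rightarrow> bool" where
  "is_mono C X Y f \<longleftrightarrow> X \<in> Obj C \<and> Y \<in> Obj C \<and> f \<in> arr C X Y \<and>
     (\<forall>W \<in> Obj C. \<forall>g \<in> arr C W X. \<forall>h \<in> arr C W X. f \<cdot>\<^bsub>C\<^esub> g = f \<cdot>\<^bsub>C\<^esub> h \<longrightarrow> g = h)"

definition is_epi :: "('o, 'm, 'k, 'x) lin_cat_scheme \<Rightarrow> 'o \<Rightarrow> 'o \<Rightarrow> 'm \<Rightarrow> bool" where
  "is_epi C X Y f \<longleftrightarrow> X \<in> Obj C \<and> Y \<in> Obj C \<and> f \<in> arr C X Y \<and>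
     (\<forall>Z \<in> Obj C. \<forall>g \<in> arr C Y Z. \<forall>h \<in> arr C Y Z. g \<cdot>\<^bsub>C\<^esub> f = h \<cdot>\<^bsub>C\<^esub> f \<longrightarrow> g = h)"

definition is_zero :: "('o, 'm, 'k, 'x) lin_cat_scheme \<Rightarrow> 'o \<Rightarrow> bool" where
  "is_zero C Z \<longleftrightarrow> Z \<in> Obj C \<and>
     (\<forall>X \<in> Obj C. (\<exists>!f. f \<in> arr C X Z) \<and> (\<exists>!f. f \<in> arr C Z X))"

text \<open>\<open>P\<close> is a biproduct of \<open>A\<close> and \<open>B\<close> with injections \<open>i1, i2\<close> and projections \<open>p1, p2\<close>.\<close>

definition is_biproduct ::
  "('o, 'm, 'k, 'x) lin_cat_scheme \<Rightarrow> 'o \<Rightarrow> 'o \<Rightarrow> 'o \<Rightarrow> 'm \<Rightarrow> 'm \<Rightarrow> 'm \<Rightarrow> 'm \<Rightarrow> bool" where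
  "is_biproduct C A B P i1 i2 p1 p2 \<longleftrightarrow> A \<in> Obj C \<and> B \<in> Obj C \<and> P \<in> Obj C \<and>
     i1 \<in> arr C A P \<and> i2 \<in> arr C B P \<and> p1 \<in> arr C P A \<and> p2 \<in> arr C P B \<and>
     p1 \<cdot>\<^bsub>C\<^esub> i1 = Ident C A \<and> p2 \<cdot>\<^bsub>C\<^esub> i2 = Ident C B \<and>
     p1 \<cdot>\<^bsub>C\<^esub> i2 = zero_arr C B A \<and> p2 \<cdot>\<^bsub>C\<^esub> i1 = zero_arr C A B \<and>
     (i1 \<cdot>\<^bsub>C\<^esub> p1) \<oplus>\<^bsub>Hom C P P\<^esub> (i2 \<cdot>\<^bsub>C\<^esub> p2) = Ident C P"

text \<open>\<open>i : N \<rightarrow> X\<close> is a kernel of \<open>f : X \<rightarrow> Y\<close>; \<open>p : Y \<rightarrow> Q\<close> is a cokernel of \<open>f : X \<rightarrow> Y\<close>.\<close>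

definition is_kernel ::
  "('o, 'm, 'k, 'x) lin_cat_scheme \<Rightarrow> 'o \<Rightarrow> 'm \<Rightarrow> 'o \<Rightarrow> 'm \<Rightarrow> 'o \<Rightarrow> bool" where
  "is_kernel C N i X f Y \<longleftrightarrow> N \<in> Obj C \<and> X \<in> Obj C \<and> Y \<in> Obj C \<and>
     i \<in> arr C N X \<and> f \<in> arr C X Y \<and> f \<cdot>\<^bsub>C\<^esub> i = zero_arr C N Y \<and>
     (\<forall>W \<in> Obj C. \<forall>g \<in> arr C W X. f \<cdot>\<^bsub>C\<^esub> g = zero_arr C W Y \<longrightarrow>
        (\<exists>!h. h \<in> arr C W N \<and> i \<cdot>\<^bsub>C\<^esub> h = g))"

definition is_cokernel ::
  "('o, 'm, 'k, 'x) lin_cat_scheme \<Rightarrow> 'o \<Rightarrow> 'm \<Rightarrow> 'o \<Rightarrow> 'm \<Rightarrow> 'o \<Rightarrow> bool" where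
  "is_cokernel C X f Y p Q \<longleftrightarrow> X \<in> Obj C \<and> Y \<in> Obj C \<and> Q \<in> Obj C \<and>
     f \<in> arr C X Y \<and> p \<in> arr C Y Q \<and> p \<cdot>\<^bsub>C\<^esub> f = zero_arr C X Q \<and>
     (\<forall>Z \<in> Obj C. \<forall>g \<in> arr C Y Z. g \<cdot>\<^bsub>C\<^esub> f = zero_arr C X Z \<longrightarrow>
        (\<exists>!h. h \<in> arr C Q Z \<and> h \<cdot>\<^bsub>C\<^esub> p = g))"

text \<open>\<open>0 \<rightarrow> X \<rightarrow> Y \<rightarrow> Z \<rightarrow> 0\<close> with maps \<open>i\<close> and \<open>p\<close> is exact.\<close>

definition short_exact ::
  "('o, 'm, 'k, 'x) lin_cat_scheme \<Rightarrow> 'o \<Rightarrow> 'm \<Rightarrow> 'o \<Rightarrow> 'm \<Rightarrow> 'o \<Rightarrow> bool" where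
  "short_exact C X i Y p Z \<longleftrightarrow> is_kernel C X i Y p Z \<and> is_cokernel C X i Y p Z"

locale abelian_category = linear_category K C
  for K :: "('k, 'r) ring_scheme" (structure)
    and C :: "('o, 'm, 'k, 'x) lin_cat_scheme" +
  assumes ex_zero: "\<exists>Z. is_zero C Z"
    and ex_biproduct: "\<lbrakk>A \<in> Obj C; B \<in> Obj C\<rbrakk> \<Longrightarrow> \<exists>P i1 i2 p1 p2. is_biproduct C A B P i1 i2 p1 p2"
    and ex_kernel: "\<lbrakk>X \<in> Obj C; Y \<in> Obj C; f \<in> arr C X Y\<rbrakk> \<Longrightarrow> \<exists>N i. is_kernel C N i X f Y"
    and ex_cokernel: "\<lbrakk>X \<in> Obj C; Y \<in> Obj C; f \<in> arr C X Y\<rbrakk> \<Longrightarrow> \<exists>Q p. is_cokernel C X f Y p Q"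
    and mono_is_kernel: "is_mono C N X i \<Longrightarrow> \<exists>Y f. is_kernel C N i X f Y"
    and epi_is_cokernel: "is_epi C Y Q p \<Longrightarrow> \<exists>X f. is_cokernel C X f Y p Q"


section \<open>Finite length and Hom-finiteness\<close>

definition is_simple :: "('o, 'm, 'k, 'x) lin_cat_scheme \<Rightarrow> 'o \<Rightarrow> bool" where
  "is_simple C S \<longleftrightarrow> S \<in> Obj C \<and> \<not> is_zero C S \<and>
     (\<forall>X f. is_mono C X S f \<longrightarrow> is_zero C X \<or> is_iso C X S f)"

text \<open>
  A derivation of \<open>finite_length C M\<close> is precisely a composition series
  \<open>0 = M\<^sub>0 \<subset> M\<^sub>1 \<subset> \<dots> \<subset> M\<^sub>n = M\<close> with simple factors.
\<close>

inductive finite_length :: "('o, 'm, 'k, 'x) lin_cat_scheme \<Rightarrow> 'o \<Rightarrow> bool" for C where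
  zero: "is_zero C M \<Longrightarrow> finite_length C M"
| step: "\<lbrakk>finite_length C X; short_exact C X i M p S; is_simple C S\<rbrakk> \<Longrightarrow> finite_length C M"

definition finite_dim :: "('k, 'r) ring_scheme \<Rightarrow> ('k, 'm, 'y) module_scheme \<Rightarrow> bool" where
  "finite_dim K V \<longleftrightarrow> (\<exists>B. finite B \<and> B \<subseteq> carrier V \<and>
     (\<forall>v \<in> carrier V. \<exists>c \<in> B \<rightarrow> carrier K. v = (\<Oplus>\<^bsub>V\<^esub>b \<in> B. c b \<odot>\<^bsub>V\<^esub> b)))"

text \<open>
  The standing assumptions on the ambient category. There is no clause for skeletal smallness:
  the objects form a set, so it holds automatically.
\<close>

locale abelian_length_category = abelian_category K C + algebraically_closed K
  for K :: "('k, 'r) ring_scheme" (structure)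
    and C :: "('o, 'm, 'k, 'x) lin_cat_scheme" +
  assumes Hom_finite: "\<lbrakk>X \<in> Obj C; Y \<in> Obj C\<rbrakk> \<Longrightarrow> finite_dim K (Hom C X Y)"
    and Obj_finite_length: "M \<in> Obj C \<Longrightarrow> finite_length C M"


section \<open>Vanishing of Hom and Ext\<close>

definition Hom_vanishes :: "('o, 'm, 'k, 'x) lin_cat_scheme \<Rightarrow> 'o \<Rightarrow> 'o \<Rightarrow> bool" where
  "Hom_vanishes C X Y \<longleftrightarrow> arr C X Y = {zero_arr C X Y}"

text \<open>
  Yoneda's first Ext group of \<open>(X, Y)\<close>: equivalence classes of short exact sequences
  \<open>0 \<rightarrow> Y \<rightarrow> E \<rightarrow> X \<rightarrow> 0\<close>, two of them being equivalent if there is an isomorphism of the middle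
  terms compatible with the identities of \<open>Y\<close> and \<open>X\<close>. Only its underlying set and its zero
  element for the Baer sum, namely the class of the split extensions, are needed here.
\<close>

definition extensions :: "('o, 'm, 'k, 'x) lin_cat_scheme \<Rightarrow> 'o \<Rightarrow> 'o \<Rightarrow> ('o \<times> 'm \<times> 'm) set" where
  "extensions C X Y = {(E, i, p). short_exact C Y i E p X}"

definition ext_equiv ::
  "('o, 'm, 'k, 'x) lin_cat_scheme \<Rightarrow> 'o \<Rightarrow> 'o \<Rightarrow> (('o \<times> 'm \<times> 'm) \<times> ('o \<times> 'm \<times> 'm)) set" where
  "ext_equiv C X Y = {((E, i, p), (E', i', p')).
     (E, i, p) \<in> extensions C X Y \<and> (E', i', p') \<in> extensions C X Y \<and>
     (\<exists>h. is_iso C E E' h \<and> h \<cdot>\<^bsub>C\<^esub> i = i' \<and> p' \<cdot>\<^bsub>C\<^esub> h = p)}"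

definition Ext1 :: "('o, 'm, 'k, 'x) lin_cat_scheme \<Rightarrow> 'o \<Rightarrow> 'o \<Rightarrow> ('o \<times> 'm \<times> 'm) set set" where
  "Ext1 C X Y = extensions C X Y // ext_equiv C X Y"

definition Ext1_zero :: "('o, 'm, 'k, 'x) lin_cat_scheme \<Rightarrow> 'o \<Rightarrow> 'o \<Rightarrow> ('o \<times> 'm \<times> 'm) set" where
  "Ext1_zero C X Y = {(E, i, p). (E, i, p) \<in> extensions C X Y \<and> (\<exists>r s. is_biproduct C Y X E i s r p)}"

definition Ext1_vanishes :: "('o, 'm, 'k, 'x) lin_cat_scheme \<Rightarrow> 'o \<Rightarrow> 'o \<Rightarrow> bool" where
  "Ext1_vanishes C X Y \<longleftrightarrow> Ext1 C X Y = {Ext1_zero C X Y}"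


section \<open>Torsion pairs\<close>

text \<open>
  Full subcategories are given by their sets of objects. As usual for torsion pairs, both members are
  required to be closed under isomorphisms.
\<close>

definition iso_closed :: "('o, 'm, 'k, 'x) lin_cat_scheme \<Rightarrow> 'o set \<Rightarrow> bool" where
  "iso_closed C S \<longleftrightarrow> (\<forall>X \<in> S. \<forall>Y f. is_iso C X Y f \<longrightarrow> Y \<in> S)"

definition right_perp :: "('o, 'm, 'k, 'x) lin_cat_scheme \<Rightarrow> 'o set \<Rightarrow> 'o set" where
  "right_perp C S = {M \<in> Obj C. \<forall>X \<in> S. Hom_vanishes C X M}"

definition left_perp :: "('o, 'm, 'k, 'x) lin_cat_scheme \<Rightarrow> 'o set \<Rightarrow> 'o set" where
  "left_perp C S = {M \<in> Obj C. \<forall>X \<in> S. Hom_vanishes C M X}"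

definition torsion_pair :: "('o, 'm, 'k, 'x) lin_cat_scheme \<Rightarrow> 'o set \<Rightarrow> 'o set \<Rightarrow> bool" where
  "torsion_pair C T F \<longleftrightarrow> T \<subseteq> Obj C \<and> F \<subseteq> Obj C \<and> iso_closed C T \<and> iso_closed C F \<and>
     (\<forall>X \<in> T. \<forall>Y \<in> F. Hom_vanishes C X Y) \<and>
     (\<forall>M \<in> Obj C. \<exists>X \<in> T. \<exists>Z \<in> F. \<exists>i p. short_exact C X i M p Z)"

text \<open>
  The torsion and torsion-free parts are unique only up to isomorphism; these are chosen representatives.
\<close>

definition torsion_part :: "('o, 'm, 'k, 'x) lin_cat_scheme \<Rightarrow> 'o set \<Rightarrow> 'o set \<Rightarrow> 'o \<Rightarrow> 'o" where
  "torsion_part C T F M = (SOME X. X \<in> T \<and> (\<exists>Z \<in> F. \<exists>i p. short_exact C X i M p Z))"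

definition torsion_free_part :: "('o, 'm, 'k, 'x) lin_cat_scheme \<Rightarrow> 'o set \<Rightarrow> 'o set \<Rightarrow> 'o \<Rightarrow> 'o" where
  "torsion_free_part C T F M = (SOME Z. Z \<in> F \<and> (\<exists>X \<in> T. \<exists>i p. short_exact C X i M p Z))"

text \<open>
  Throughout, the totally ordered index set is an arbitrary subset \<open>G\<close> of a linearly ordered type, and
  families indexed by \<open>G\<close> are functions whose values outside \<open>G\<close> are irrelevant.
\<close>

definition nested_torsion_pairs ::
  "('o, 'm, 'k, 'x) lin_cat_scheme \<Rightarrow> 'g::linorder set \<Rightarrow> ('g \<Rightarrow> 'o set) \<Rightarrow> ('g \<Rightarrow> 'o set) \<Rightarrow> bool" where
  "nested_torsion_pairs C G T F \<longleftrightarrow>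
     (\<forall>k \<in> G. torsion_pair C (T k) (F k)) \<and> (\<forall>k \<in> G. \<forall>l \<in> G. k < l \<longrightarrow> T l \<subset> T k)"

definition pre_stratifying_system ::
  "('o, 'm, 'k, 'x) lin_cat_scheme \<Rightarrow> 'g::linorder set \<Rightarrow> ('g \<Rightarrow> 'o) \<Rightarrow> bool" where
  "pre_stratifying_system C G \<Omega> \<longleftrightarrow>
     (\<forall>k \<in> G. \<Omega> k \<in> Obj C \<and> \<not> is_zero C (\<Omega> k)) \<and>
     (\<forall>k \<in> G. \<forall>j \<in> G. k > j \<longrightarrow> Hom_vanishes C (\<Omega> k) (\<Omega> j)) \<and>
     (\<forall>k \<in> G. \<forall>j \<in> G. k \<ge> j \<longrightarrow> Ext1_vanishes C (\<Omega> k) (\<Omega> j))"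


section \<open>Graded objects\<close>

text \<open>The objects of \<open>Gr\<^sub>G(C)\<close>. Below, full subcategories of it are given by their objects.\<close>

definition Gr_obj :: "('o, 'm, 'k, 'x) lin_cat_scheme \<Rightarrow> 'g set \<Rightarrow> ('g \<Rightarrow> 'o) set" where
  "Gr_obj C G = G \<rightarrow> Obj C"

definition Gr_zero :: "('o, 'm, 'k, 'x) lin_cat_scheme \<Rightarrow> 'g set \<Rightarrow> ('g \<Rightarrow> 'o) \<Rightarrow> bool" where
  "Gr_zero C G M \<longleftrightarrow> (\<forall>k \<in> G. is_zero C (M k))"

definition M_cat ::
  "('o, 'm, 'k, 'x) lin_cat_scheme \<Rightarrow> 'g::linorder set \<Rightarrow> ('g \<Rightarrow> 'o set) \<Rightarrow> ('g \<Rightarrow> 'o) set" where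
  "M_cat C G T = {M \<in> Gr_obj C G. Gr_zero C G M \<or>
     (\<forall>k \<in> G. \<not> is_zero C (M k) \<and> M k \<in> T k \<and> (\<forall>j \<in> G. j > k \<longrightarrow> M k \<notin> T j))}"

definition N_cat ::
  "('o, 'm, 'k, 'x) lin_cat_scheme \<Rightarrow> 'g::linorder set \<Rightarrow> ('g \<Rightarrow> 'o set) \<Rightarrow> ('g \<Rightarrow> 'o) set" where
  "N_cat C G F = {N \<in> Gr_obj C G. Gr_zero C G N \<or>
     (\<forall>k \<in> G. \<not> is_zero C (N k) \<and> N k \<in> F k \<and> (\<forall>j \<in> G. j < k \<longrightarrow> N k \<notin> F j))}"

text \<open>
  The intersections of all \<open>F\<^sub>j\<close> with \<open>j > k\<close>, resp. of all \<open>T\<^sub>j\<close> with \<open>j < k\<close>. Intersecting with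
  \<open>Obj C\<close> gives the value \<open>Obj C\<close> if \<open>k\<close> is the maximum, resp. minimum, of \<open>G\<close>, and changes
  nothing otherwise.
\<close>

definition F_above ::
  "('o, 'm, 'k, 'x) lin_cat_scheme \<Rightarrow> 'g::linorder set \<Rightarrow> ('g \<Rightarrow> 'o set) \<Rightarrow> 'g \<Rightarrow> 'o set" where
  "F_above C G F k = Obj C \<inter> (\<Inter>j \<in> {j \<in> G. j > k}. F j)"

definition T_below ::
  "('o, 'm, 'k, 'x) lin_cat_scheme \<Rightarrow> 'g::linorder set \<Rightarrow> ('g \<Rightarrow> 'o set) \<Rightarrow> 'g \<Rightarrow> 'o set" where
  "T_below C G T k = Obj C \<inter> (\<Inter>j \<in> {j \<in> G. j < k}. T j)"

definition frak_F ::
  "('o, 'm, 'k, 'x) lin_cat_scheme \<Rightarrow> 'g::linorder set \<Rightarrow> ('g \<Rightarrow> 'o set) \<Rightarrow> ('g \<Rightarrow> 'o) \<Rightarrow> 'g \<Rightarrow> 'o" where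
  "frak_F C G F M k = torsion_free_part C (left_perp C (F_above C G F k)) (F_above C G F k) (M k)"

definition frak_T ::
  "('o, 'm, 'k, 'x) lin_cat_scheme \<Rightarrow> 'g::linorder set \<Rightarrow> ('g \<Rightarrow> 'o set) \<Rightarrow> ('g \<Rightarrow> 'o) \<Rightarrow> 'g \<Rightarrow> 'o" where
  "frak_T C G T N k = torsion_part C (T_below C G T k) (right_perp C (T_below C G T k)) (N k)"

definition M_dagger ::
  "('o, 'm, 'k, 'x) lin_cat_scheme \<Rightarrow> 'g::linorder set \<Rightarrow> ('g \<Rightarrow> 'o set) \<Rightarrow> ('g \<Rightarrow> 'o set)
    \<Rightarrow> ('g \<Rightarrow> 'o) set" where
  "M_dagger C G T F = {M \<in> M_cat C G T. \<not> Gr_zero C G M \<and>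
     (\<forall>k \<in> G. \<forall>j \<in> G. k \<ge> j \<longrightarrow> Ext1_vanishes C (M k) (frak_F C G F M j))}"

definition N_dagger ::
  "('o, 'm, 'k, 'x) lin_cat_scheme \<Rightarrow> 'g::linorder set \<Rightarrow> ('g \<Rightarrow> 'o set) \<Rightarrow> ('g \<Rightarrow> 'o set)
    \<Rightarrow> ('g \<Rightarrow> 'o) set" where
  "N_dagger C G T F = {N \<in> N_cat C G F. \<not> Gr_zero C G N \<and>
     (\<forall>k \<in> G. \<forall>j \<in> G. k \<ge> j \<longrightarrow> Ext1_vanishes C (frak_T C G T N k) (N j))}"

end

theory Submission
  imports Defs
begin

text \<open>
  Let \<open>0 \<rightarrow> t\<^sub>k \<rightarrow> M\<^sub>k \<rightarrow> \<Omega>\<^sub>k \<rightarrow> 0\<close> be the torsion sequence of \<open>M\<^sub>k\<close> for the torsion-free class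
  \<open>A\<^sub>k = \<Inter>\<^bsub>j>k\<^esub> F\<^sub>j\<close>. By finite length, the torsion parts of \<open>M\<^sub>k\<close> for the pairs with \<open>j > k\<close>
  stabilise, so the sequence exists and, unless \<open>k\<close> is the maximum of \<open>G\<close>, \<open>t\<^sub>k\<close> lies in \<open>T\<^sub>j\<close> for
  some \<open>j > k\<close>; hence \<open>\<Omega>\<^sub>k \<noteq> 0\<close>. For \<open>j < k\<close>, a map \<open>\<Omega>\<^sub>k \<rightarrow> \<Omega>\<^sub>j\<close> composes with \<open>M\<^sub>k \<rightarrow> \<Omega>\<^sub>k\<close> to
  a map from \<open>T\<^sub>k\<close> to \<open>F\<^sub>k\<close>, so it vanishes. For \<open>j \<le> k\<close> we have \<open>Hom(t\<^sub>k, \<Omega>\<^sub>j) = 0\<close>, so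
  \<open>Ext\<^sup>1(\<Omega>\<^sub>k, \<Omega>\<^sub>j)\<close> embeds into \<open>Ext\<^sup>1(M\<^sub>k, \<Omega>\<^sub>j) = 0\<close>. The second part is the first one in the
  opposite category with the order of \<open>G\<close> reversed.
\<close>

section \<open>Auxiliary notions: split extensions, length, typed arrows\<close>

text \<open>Vanishing of Ext in terms of sections alone, without equivalence classes. For objects
  \<open>X\<close> and \<open>Y\<close> it agrees with \<open>Ext1_vanishes\<close>, as shown
  below.\<close>

definition all_split :: "('o, 'm, 'k, 'x) lin_cat_scheme \<Rightarrow> 'o \<Rightarrow> 'o \<Rightarrow> bool" where
  "all_split C X Y \<longleftrightarrow> (\<forall>E i p. short_exact C Y i E p X \<longrightarrow> (\<exists>s \<in> arr C X E. p \<cdot>\<^bsub>C\<^esub> s = Ident C X))"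

text \<open>
  A relation rather than a function, so that no Jordan--Hoelder theorem is needed; unlike
  \<^const>\<open>finite_length\<close>, the notion is visibly self-dual.
\<close>

definition length_function :: "('o, 'm, 'k, 'x) lin_cat_scheme \<Rightarrow> (nat \<Rightarrow> 'o \<Rightarrow> bool) \<Rightarrow> bool" where
  "length_function C L \<longleftrightarrow> (\<forall>M \<in> Obj C. \<exists>n. L n M) \<and> (\<forall>M. L 0 M \<longrightarrow> is_zero C M) \<and>
     (\<forall>n X i M p Z. short_exact C X i M p Z \<longrightarrow> L n M \<longrightarrow> (\<exists>a b. a + b = n \<and> L a X \<and> L b Z))"

text \<open>\<open>finite_length\<close> with the number of simple factors of the chosen composition
  series recorded.\<close>

inductive comp_length :: "('o, 'm, 'k, 'x) lin_cat_scheme \<Rightarrow> nat \<Rightarrow> 'o \<Rightarrow> bool" for C where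
  zero: "is_zero C M \<Longrightarrow> comp_length C 0 M"
| step: "\<lbrakk>comp_length C n X; short_exact C X i M p S; is_simple C S\<rbrakk> \<Longrightarrow> comp_length C (Suc n) M"

text \<open>Hom-sets may overlap, so an arrow must carry its endpoints. Bundling them with
  membership in \<open>Obj\<close> leaves one premise per arrow in the rules below.\<close>

definition arrow :: "('o, 'm, 'k, 'x) lin_cat_scheme \<Rightarrow> 'm \<Rightarrow> 'o \<Rightarrow> 'o \<Rightarrow> bool" where
  "arrow C f X Y \<longleftrightarrow> X \<in> Obj C \<and> Y \<in> Obj C \<and> f \<in> arr C X Y"

section \<open>Calculus of arrows in a linear category\<close>

context linear_category
begin

abbreviation ar :: "'m \<Rightarrow> 'o \<Rightarrow> 'o \<Rightarrow> bool" where
  "ar \<equiv> arrow C"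

abbreviation comp_C :: "'m \<Rightarrow> 'm \<Rightarrow> 'm" (infixr \<open>\<star>\<close> 70) where
  "g \<star> f \<equiv> g \<cdot>\<^bsub>C\<^esub> f"

abbreviation zr :: "'o \<Rightarrow> 'o \<Rightarrow> 'm" where
  "zr \<equiv> zero_arr C"

abbreviation add_C :: "'o \<Rightarrow> 'o \<Rightarrow> 'm \<Rightarrow> 'm \<Rightarrow> 'm" where
  "add_C X Y f g \<equiv> f \<oplus>\<^bsub>Hom C X Y\<^esub> g"

lemma Hom_abelian_group: "\<lbrakk>X \<in> Obj C; Y \<in> Obj C\<rbrakk> \<Longrightarrow> abelian_group (Hom C X Y)"
  using Hom_module module.axioms(2) by blast

lemma ar_objD: "ar f X Y \<Longrightarrow> X \<in> Obj C" "ar f X Y \<Longrightarrow> Y \<in> Obj C"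
  by (auto simp: arrow_def)

lemma ar_id: "X \<in> Obj C \<Longrightarrow> ar (Ident C X) X X"
  by (simp add: arrow_def Ident_arr)

lemma ar_comp: "\<lbrakk>ar g Y Z; ar f X Y\<rbrakk> \<Longrightarrow> ar (g \<star> f) X Z"
  by (auto simp: arrow_def intro: Comp_arr)

lemma ar_zero: "\<lbrakk>X \<in> Obj C; Y \<in> Obj C\<rbrakk> \<Longrightarrow> ar (zr X Y) X Y"
  by (simp add: arrow_def Hom_abelian_group abelian_group.axioms(1) abelian_monoid.zero_closed)

lemma ar_add: "\<lbrakk>ar f X Y; ar g X Y\<rbrakk> \<Longrightarrow> ar (add_C X Y f g) X Y"
  by (simp add: arrow_def Hom_abelian_group abelian_group.axioms(1) abelian_monoid.a_closed)

lemma comp_id: "ar f X Y \<Longrightarrow> f \<star> Ident C X = f" "ar f X Y \<Longrightarrow> Ident C Y \<star> f = f"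
  by (auto simp: arrow_def intro: Comp_Ident_right Comp_Ident_left)

lemma assoc: "\<lbrakk>ar h Y Z; ar g X Y; ar f W X\<rbrakk> \<Longrightarrow> (h \<star> g) \<star> f = h \<star> g \<star> f"
  by (rule Comp_assoc[of W X Y Z]) (auto simp: arrow_def)

lemma distr: "\<lbrakk>ar g Y Z; ar f X Y; ar f' X Y\<rbrakk> \<Longrightarrow> g \<star> add_C X Y f f' = add_C X Z (g \<star> f) (g \<star> f')"
  "\<lbrakk>ar h Y Z; ar h' Y Z; ar f X Y\<rbrakk> \<Longrightarrow> add_C Y Z h h' \<star> f = add_C X Z (h \<star> f) (h' \<star> f)"
  by (auto simp: arrow_def intro: Comp_add_right Comp_add_left)

lemma add_zero: "ar f X Y \<Longrightarrow> add_C X Y f (zr X Y) = f" "ar f X Y \<Longrightarrow> add_C X Y (zr X Y) f = f"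
  by (auto simp: arrow_def Hom_abelian_group abelian_group.axioms(1) abelian_monoid.r_zero abelian_monoid.l_zero)

lemma add_eq_self: "\<lbrakk>ar f X Y; ar g X Y; add_C X Y f g = f\<rbrakk> \<Longrightarrow> g = zr X Y"
proof -
  assume *: "ar f X Y" "ar g X Y" "add_C X Y f g = f"
  interpret abelian_group "Hom C X Y" using * ar_objD by (intro Hom_abelian_group) auto
  show ?thesis using * a_assoc l_neg l_zero a_inv_closed by (metis arrow_def)
qed

text \<open>Bilinearity turns 0 + 0 = 0 into x + x = x for the composite x, and cancelling gives x =
  0.\<close>

lemma comp_zero: "\<lbrakk>ar g Y Z; X \<in> Obj C\<rbrakk> \<Longrightarrow> g \<star> zr X Y = zr X Z"
  "\<lbrakk>ar f X Y; Z \<in> Obj C\<rbrakk> \<Longrightarrow> zr Y Z \<star> f = zr X Z"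
proof -
  assume g: "ar g Y Z" and X: "X \<in> Obj C"
  have z: "ar (zr X Y) X Y" by (rule ar_zero) (use g X ar_objD in auto)
  from distr(1)[OF g z z] add_zero(1)[OF z]
  show "g \<star> zr X Y = zr X Z" using add_eq_self[OF ar_comp[OF g z] ar_comp[OF g z]] by simp
next
  assume f: "ar f X Y" and Z: "Z \<in> Obj C"
  have z: "ar (zr Y Z) Y Z" by (rule ar_zero) (use f Z ar_objD in auto)
  from distr(2)[OF z z f] add_zero(1)[OF z]
  show "zr Y Z \<star> f = zr X Z" using add_eq_self[OF ar_comp[OF z f] ar_comp[OF z f]] by simp
qed

lemma ex_neg: "ar f X Y \<Longrightarrow> \<exists>g. ar g X Y \<and> add_C X Y f g = zr X Y"
  by (metis Hom_abelian_group abelian_group.a_inv_closed abelian_group.r_neg arrow_def)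

lemma ex_diff: "\<lbrakk>ar f X Y; ar g X Y\<rbrakk> \<Longrightarrow> \<exists>h. ar h X Y \<and> add_C X Y g h = f"
proof -
  assume *: "ar f X Y" "ar g X Y"
  interpret abelian_group "Hom C X Y" using * ar_objD by (intro Hom_abelian_group) auto
  show ?thesis using * a_assoc r_neg l_zero a_inv_closed a_closed by (metis arrow_def)
qed

lemma add_comm: "\<lbrakk>ar f X Y; ar g X Y\<rbrakk> \<Longrightarrow> add_C X Y f g = add_C X Y g f"
  by (simp add: arrow_def Hom_abelian_group abelian_group.axioms(1) abelian_monoid.a_comm)

lemma add_right_cancel: "\<lbrakk>ar f X Y; ar g X Y; ar h X Y; add_C X Y f h = add_C X Y g h\<rbrakk> \<Longrightarrow> f = g"
proof -
  assume *: "ar f X Y" "ar g X Y" "ar h X Y" "add_C X Y f h = add_C X Y g h"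
  interpret abelian_group "Hom C X Y" using * ar_objD by (intro Hom_abelian_group) auto
  show ?thesis using * a_assoc r_neg r_zero a_inv_closed by (metis arrow_def)
qed

lemma eq_iff_add_neg:
  assumes "ar f X Y" "ar g X Y" "ar h X Y" "add_C X Y g h = zr X Y"
  shows "add_C X Y f h = zr X Y \<longleftrightarrow> f = g"
  using assms add_right_cancel by metis

section \<open>Monomorphisms, epimorphisms, kernels and cokernels\<close>

text \<open>Two arrows with equal composites have a difference that \<open>f\<close> kills, so
  cancellation need only be tested against zero.\<close>

lemma monoI:
  assumes f: "ar f X Y" and *: "\<And>W g. \<lbrakk>ar g W X; f \<star> g = zr W Y\<rbrakk> \<Longrightarrow> g = zr W X"
  shows "is_mono C X Y f"
  unfolding is_mono_def
proof (intro conjI ballI impI)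
  fix W g h assume W: "W \<in> Obj C" and "g \<in> arr C W X" "h \<in> arr C W X" and eq: "f \<star> g = f \<star> h"
  then have g: "ar g W X" and h: "ar h W X" using f by (auto simp: arrow_def)
  obtain n where n: "ar n W X" "add_C W X h n = zr W X" using ex_neg[OF h] by blast
  have "f \<star> add_C W X g n = f \<star> add_C W X h n"
    using distr(1)[OF f g n(1)] distr(1)[OF f h n(1)] eq by simp
  also have "\<dots> = zr W Y" using n comp_zero(1)[OF f W] by simp
  finally have "add_C W X g n = zr W X" using *[OF ar_add[OF g n(1)]] by blast
  then show "g = h" using eq_iff_add_neg[OF g h n] by blast
qed (use f in \<open>auto simp: arrow_def\<close>)

lemma epiI:
  assumes f: "ar f X Y" and *: "\<And>Z g. \<lbrakk>ar g Y Z; g \<star> f = zr X Z\<rbrakk> \<Longrightarrow> g = zr Y Z"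
  shows "is_epi C X Y f"
  unfolding is_epi_def
proof (intro conjI ballI impI)
  fix Z g h assume Z: "Z \<in> Obj C" and "g \<in> arr C Y Z" "h \<in> arr C Y Z" and eq: "g \<star> f = h \<star> f"
  then have g: "ar g Y Z" and h: "ar h Y Z" using f by (auto simp: arrow_def)
  obtain n where n: "ar n Y Z" "add_C Y Z h n = zr Y Z" using ex_neg[OF h] by blast
  have "add_C Y Z g n \<star> f = add_C Y Z h n \<star> f"
    using distr(2)[OF g n(1) f] distr(2)[OF h n(1) f] eq by simp
  also have "\<dots> = zr X Z" using n comp_zero(2)[OF f Z] by simp
  finally have "add_C Y Z g n = zr Y Z" using *[OF ar_add[OF g n(1)]] by blast
  then show "g = h" using eq_iff_add_neg[OF g h n] by blast
qed (use f in \<open>auto simp: arrow_def\<close>)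

lemma monoD: "\<lbrakk>is_mono C X Y f; ar g W X; ar h W X; f \<star> g = f \<star> h\<rbrakk> \<Longrightarrow> g = h"
  by (auto simp: arrow_def is_mono_def)

lemma epiD: "\<lbrakk>is_epi C X Y f; ar g Y Z; ar h Y Z; g \<star> f = h \<star> f\<rbrakk> \<Longrightarrow> g = h"
  by (auto simp: arrow_def is_epi_def)

lemma mono_ar: "is_mono C X Y f \<Longrightarrow> ar f X Y"
  by (auto simp: arrow_def is_mono_def)

lemma epi_ar: "is_epi C X Y f \<Longrightarrow> ar f X Y"
  by (auto simp: arrow_def is_epi_def)

lemma mono_zeroD: "\<lbrakk>is_mono C X Y f; ar g W X; f \<star> g = zr W Y\<rbrakk> \<Longrightarrow> g = zr W X"
  by (metis comp_zero(1) monoD ar_zero mono_ar ar_objD)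

lemma epi_zeroD: "\<lbrakk>is_epi C X Y f; ar g Y Z; g \<star> f = zr X Z\<rbrakk> \<Longrightarrow> g = zr Y Z"
  by (metis comp_zero(2) epiD ar_zero epi_ar ar_objD)

lemma kernel_ar:
  assumes "is_kernel C N i X f Y"
  shows "ar i N X" "ar f X Y" "f \<star> i = zr N Y"
  using assms by (auto simp: is_kernel_def arrow_def)

lemma cokernel_ar:
  assumes "is_cokernel C X f Y p Q"
  shows "ar f X Y" "ar p Y Q" "p \<star> f = zr X Q"
  using assms by (auto simp: is_cokernel_def arrow_def)

lemma kernel_lift:
  assumes "is_kernel C N i X f Y" "ar g W X" "f \<star> g = zr W Y"
  obtains h where "ar h W N" "i \<star> h = g"
  using assms unfolding is_kernel_def arrow_def by metis

lemma cokernel_desc: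
  assumes "is_cokernel C X f Y p Q" "ar g Y Z" "g \<star> f = zr X Z"
  obtains h where "ar h Q Z" "h \<star> p = g"
  using assms unfolding is_cokernel_def arrow_def by metis

lemma kernel_mono:
  assumes k: "is_kernel C N i X f Y"
  shows "is_mono C N X i"
proof -
  note a = kernel_ar[OF k]
  have "g = h" if g: "ar g W N" and h: "ar h W N" and eq: "i \<star> g = i \<star> h" for W g h
  proof -
    have "f \<star> (i \<star> g) = zr W Y"
      using assoc[OF a(2,1) g] a(3) comp_zero(2)[OF g] a(2) ar_objD(2) by metis
    moreover have "ar (i \<star> g) W X" by (rule ar_comp[OF a(1) g])
    ultimately have "\<exists>!h. h \<in> arr C W N \<and> i \<star> h = i \<star> g"
      using k unfolding is_kernel_def arrow_def by blast
    then show ?thesis using g h eq unfolding arrow_def by metis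
  qed
  then show ?thesis using a(1) unfolding is_mono_def arrow_def by blast
qed

lemma cokernel_epi:
  assumes k: "is_cokernel C X f Y p Q"
  shows "is_epi C Y Q p"
proof -
  note a = cokernel_ar[OF k]
  have "g = h" if g: "ar g Q W" and h: "ar h Q W" and eq: "g \<star> p = h \<star> p" for W g h
  proof -
    have "(g \<star> p) \<star> f = zr X W"
      using assoc[OF g a(2,1)] a(3) comp_zero(1)[OF g] a(1) ar_objD(1) by metis
    moreover have "ar (g \<star> p) Y W" by (rule ar_comp[OF g a(2)])
    ultimately have "\<exists>!h. h \<in> arr C Q W \<and> h \<star> p = g \<star> p"
      using k unfolding is_cokernel_def arrow_def by blast
    then show ?thesis using g h eq unfolding arrow_def by metis
  qed
  then show ?thesis using a(2) unfolding is_epi_def arrow_def by blast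
qed

text \<open>Uniqueness of lifts is automatic for a monomorphism, which leaves only their existence
  to check.\<close>

lemma kernelI:
  assumes "is_mono C N X i" "ar f X Y" "f \<star> i = zr N Y"
    and "\<And>W g. \<lbrakk>ar g W X; f \<star> g = zr W Y\<rbrakk> \<Longrightarrow> \<exists>h. ar h W N \<and> i \<star> h = g"
  shows "is_kernel C N i X f Y"
proof -
  have "\<exists>!h. h \<in> arr C W N \<and> i \<star> h = g"
    if "W \<in> Obj C" "g \<in> arr C W X" "f \<star> g = zr W Y" for W g
  proof -
    have "\<exists>h. ar h W N \<and> i \<star> h = g" using assms(2,4) that by (auto simp: arrow_def)
    then show ?thesis using monoD[OF assms(1)] by (metis arrow_def)
  qed
  then show ?thesis using assms(1-3) by (auto simp: is_kernel_def is_mono_def arrow_def)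
qed

section \<open>Zero objects and short exact sequences\<close>

lemma is_zero_ar_unique: "\<lbrakk>is_zero C Z; ar f X Z\<rbrakk> \<Longrightarrow> f = zr X Z" "\<lbrakk>is_zero C Z; ar g Z X\<rbrakk> \<Longrightarrow> g = zr Z X"
  by (metis is_zero_def arrow_def ar_zero)+

text \<open>Every arrow into or out of \<open>Z\<close> absorbs the identity of \<open>Z\<close>, so
  it vanishes as soon as that identity does.\<close>

lemma is_zero_iff: "is_zero C Z \<longleftrightarrow> Z \<in> Obj C \<and> Ident C Z = zr Z Z"
proof
  assume "is_zero C Z"
  then show "Z \<in> Obj C \<and> Ident C Z = zr Z Z"
    using is_zero_ar_unique(1) ar_id by (auto simp: is_zero_def)
next
  assume Z: "Z \<in> Obj C \<and> Ident C Z = zr Z Z"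
  have "f = zr X Z" if "ar f X Z" for f X
    using comp_id(2)[OF that] comp_zero(2)[OF that] Z by metis
  moreover have "f = zr Z X" if "ar f Z X" for f X
    using comp_id(1)[OF that] comp_zero(1)[OF that] Z by metis
  ultimately show "is_zero C Z" using Z ar_zero unfolding is_zero_def arrow_def by metis
qed

lemma isoI: "\<lbrakk>ar f X Y; ar g Y X; g \<star> f = Ident C X; f \<star> g = Ident C Y\<rbrakk> \<Longrightarrow> is_iso C X Y f"
  by (auto simp: is_iso_def arrow_def)

lemma isoE:
  assumes "is_iso C X Y f"
  obtains g where "ar f X Y" "ar g Y X" "g \<star> f = Ident C X" "f \<star> g = Ident C Y"
  using assms by (auto simp: is_iso_def arrow_def)

lemma short_exactD:
  assumes "short_exact C X i Y p Z"
  shows "is_kernel C X i Y p Z" "is_cokernel C X i Y p Z" "is_mono C X Y i" "is_epi C Y Z p"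
    "ar i X Y" "ar p Y Z" "p \<star> i = zr X Z"
  using assms kernel_mono cokernel_epi kernel_ar by (auto simp: short_exact_def)

text \<open>The identity of \<open>Y\<close> kills \<open>i\<close>, hence descends along
  \<open>p\<close> to an inverse of \<open>p\<close>. The isomorphism goes from \<open>Z\<close> to
  \<open>Y\<close> because membership in a class is later transported in that direction.\<close>

lemma short_exact_left_zero_iso:
  assumes "short_exact C X i Y p Z" "is_zero C X"
  shows "\<exists>s. is_iso C Z Y s"
proof -
  note e = short_exactD[OF assms(1)]
  have Y: "Y \<in> Obj C" and Z: "Z \<in> Obj C" using e(6) ar_objD by auto
  have "Ident C Y \<star> i = zr X Y" using comp_id(2)[OF e(5)] is_zero_ar_unique(2)[OF assms(2) e(5)] by simp
  from cokernel_desc[OF e(2) ar_id[OF Y] this]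
  obtain s where s: "ar s Z Y" "s \<star> p = Ident C Y" .
  have "(p \<star> s) \<star> p = Ident C Z \<star> p" using assoc[OF e(6) s(1) e(6)] s(2) comp_id[OF e(6)] by simp
  from epiD[OF e(4) ar_comp[OF e(6) s(1)] ar_id[OF Z] this] show ?thesis
    using isoI[OF s(1) e(6)] s(2) by blast
qed

lemma short_exact_right_zero_iso:
  assumes "short_exact C X i Y p Z" "is_zero C Z"
  shows "is_iso C X Y i"
proof -
  note e = short_exactD[OF assms(1)]
  have Y: "Y \<in> Obj C" and X: "X \<in> Obj C" using e(5) ar_objD by auto
  have "p \<star> Ident C Y = zr Y Z" using comp_id(1)[OF e(6)] is_zero_ar_unique(1)[OF assms(2) e(6)] by simp
  from kernel_lift[OF e(1) ar_id[OF Y] this]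
  obtain s where s: "ar s Y X" "i \<star> s = Ident C Y" .
  have "i \<star> (s \<star> i) = i \<star> Ident C X" using assoc[OF e(5) s(1) e(5)] s(2) comp_id[OF e(5)] by simp
  from monoD[OF e(3) ar_comp[OF s(1) e(5)] ar_id[OF X] this] show ?thesis
    using isoI[OF e(5) s(1)] s(2) by blast
qed


text \<open>This is the torsion sequence of \<open>N\<close> when every object counts as
  torsion-free, the situation at the maximum of the index set.\<close>

lemma zero_obj_short_exact:
  assumes Z: "is_zero C Z" and N: "N \<in> Obj C"
  shows "short_exact C Z (zr Z N) N (Ident C N) N"
proof -
  have Zo: "Z \<in> Obj C" using Z by (simp add: is_zero_def)
  have "is_mono C Z N (zr Z N)"
    using is_zero_ar_unique(1)[OF Z] by (intro monoI ar_zero Zo N) auto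
  moreover have "Ident C N \<star> zr Z N = zr Z N" using comp_id(2) ar_zero Zo N by blast
  moreover have "\<exists>h. ar h W Z \<and> zr Z N \<star> h = g" if "ar g W N" "Ident C N \<star> g = zr W N" for W g
  proof -
    have W: "W \<in> Obj C" using that(1) ar_objD by blast
    have "g = zr W N" using that comp_id(2) by metis
    then show ?thesis using comp_zero(1)[OF ar_zero[OF Zo N] W] ar_zero[OF W Zo] by metis
  qed
  ultimately have "is_kernel C Z (zr Z N) N (Ident C N) N"
    using ar_id[OF N] by (intro kernelI) auto
  moreover have "\<exists>!h. h \<in> arr C N W \<and> h \<star> Ident C N = g" if "W \<in> Obj C" "g \<in> arr C N W" for W g
    using that N comp_id(1) by (metis arrow_def)
  ultimately show ?thesis
    using Zo N by (auto simp: short_exact_def is_cokernel_def is_kernel_def)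
qed

end

section \<open>Exactness and pullbacks in an abelian category\<close>

context abelian_category
begin

lemma ex_kernel_ar: "ar f X Y \<Longrightarrow> \<exists>N i. is_kernel C N i X f Y"
  using ex_kernel by (simp add: arrow_def)

lemma ex_cokernel_ar: "ar f X Y \<Longrightarrow> \<exists>Q p. is_cokernel C X f Y p Q"
  using ex_cokernel by (simp add: arrow_def)

text \<open>The epimorphism \<open>p\<close> is a cokernel of some \<open>f\<close>, and
  \<open>f\<close> factors through the kernel \<open>i\<close>. So whatever kills \<open>i\<close>
  also kills \<open>f\<close> and descends along \<open>p\<close>.\<close>

lemma short_exactI_epi:
  assumes p: "is_epi C Y Q p" and k: "is_kernel C N i Y p Q"
  shows "short_exact C N i Y p Q"
proof -
  obtain X f where f: "is_cokernel C X f Y p Q" using epi_is_cokernel[OF p] by blast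
  note kk = kernel_ar[OF k] and ff = cokernel_ar[OF f]
  obtain f' where f': "ar f' X N" "i \<star> f' = f" using kernel_lift[OF k ff(1,3)] by blast
  have "\<exists>!h. h \<in> arr C Q Z \<and> h \<star> p = g" if g: "ar g Y Z" "g \<star> i = zr N Z" for Z g
  proof -
    have "g \<star> f = zr X Z"
      using assoc[OF g(1) kk(1) f'(1)] f'(2) g(2) comp_zero(2)[OF f'(1)] g(1) ar_objD(2) by metis
    from cokernel_desc[OF f g(1) this] obtain h where "ar h Q Z" "h \<star> p = g" .
    then show ?thesis using epiD[OF p] by (metis arrow_def)
  qed
  then have "is_cokernel C N i Y p Q"
    using kk unfolding is_cokernel_def arrow_def by blast
  with k show ?thesis by (simp add: short_exact_def)
qed

text \<open>The pullback of \<open>p\<close> and \<open>q\<close> is the kernel of \<open>p \<circ> pr\<^sub>1 - q \<circ> pr\<^sub>2\<close> on the biproduct.\<close>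

lemma epi_pullback:
  assumes p: "is_epi C E Z p" and q: "ar q M Z"
  obtains P e1 e2 where "ar e1 P E" "is_epi C P M e2" "p \<star> e1 = q \<star> e2"
    "\<And>W f g. \<lbrakk>ar f W E; ar g W M; p \<star> f = q \<star> g\<rbrakk> \<Longrightarrow> \<exists>h. ar h W P \<and> e1 \<star> h = f \<and> e2 \<star> h = g"
    "\<And>W h h'. \<lbrakk>ar h W P; ar h' W P; e1 \<star> h = e1 \<star> h'; e2 \<star> h = e2 \<star> h'\<rbrakk> \<Longrightarrow> h = h'"
proof -
  note pa = epi_ar[OF p]
  have obs: "E \<in> Obj C" "Z \<in> Obj C" "M \<in> Obj C" using pa q ar_objD by auto
  obtain B i1 i2 p1 p2 where B: "is_biproduct C E M B i1 i2 p1 p2"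
    using ex_biproduct obs by metis
  have a: "ar i1 E B" "ar i2 M B" "ar p1 B E" "ar p2 B M" and BO: "B \<in> Obj C"
    and b: "p1 \<star> i1 = Ident C E" "p2 \<star> i2 = Ident C M" "p1 \<star> i2 = zr M E" "p2 \<star> i1 = zr E M"
      "add_C B B (i1 \<star> p1) (i2 \<star> p2) = Ident C B"
    using B by (auto simp: is_biproduct_def arrow_def)
  obtain n where n: "ar n M Z" "add_C M Z q n = zr M Z" using ex_neg[OF q] by blast
  note pp = ar_comp[OF pa a(3)] and np = ar_comp[OF n(1) a(4)]
  \<comment> \<open>\<open>n\<close> is the negative of \<open>q\<close>, so this is the difference
    map whose kernel is the pullback.\<close>
  define d where "d = add_C B Z (p \<star> p1) (n \<star> p2)"
  have d: "ar d B Z" unfolding d_def by (rule ar_add[OF pp np])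
  have dzero: "d \<star> x = zr W Z \<longleftrightarrow> p \<star> p1 \<star> x = q \<star> p2 \<star> x" if x: "ar x W B" for x W
  proof -
    note p2x = ar_comp[OF a(4) x] and p1x = ar_comp[OF a(3) x]
    have W: "W \<in> Obj C" using x ar_objD by blast
    have "d \<star> x = add_C W Z (p \<star> p1 \<star> x) (n \<star> p2 \<star> x)"
      unfolding d_def distr(2)[OF pp np x] assoc[OF pa a(3) x] assoc[OF n(1) a(4) x] ..
    moreover have "add_C W Z (q \<star> p2 \<star> x) (n \<star> p2 \<star> x) = zr W Z"
      using distr(2)[OF q n(1) p2x] n(2) comp_zero(2)[OF p2x obs(2)] by simp
    ultimately show ?thesis
      using eq_iff_add_neg[OF ar_comp[OF pa p1x] ar_comp[OF q p2x] ar_comp[OF n(1) p2x]] by simp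
  qed
  \<comment> \<open>Restricting to the summand \<open>E\<close> recovers \<open>p\<close>; hence
    \<open>d\<close> is an epimorphism and also a cokernel of its kernel.\<close>
  have di1: "d \<star> i1 = p"
  proof -
    have "d \<star> i1 = add_C E Z (p \<star> p1 \<star> i1) (n \<star> p2 \<star> i1)"
      unfolding d_def distr(2)[OF pp np a(1)] assoc[OF pa a(3) a(1)] assoc[OF n(1) a(4) a(1)] ..
    also have "\<dots> = p" using b comp_id(1)[OF pa] comp_zero(1)[OF n(1) obs(1)] add_zero(1)[OF pa] by simp
    finally show ?thesis .
  qed
  have depi: "is_epi C B Z d"
  proof (rule epiI[OF d])
    fix Y g assume g: "ar g Z Y" and g0: "g \<star> d = zr B Y"
    have "g \<star> p = zr E Y"
      using assoc[OF g d a(1)] di1 g0 comp_zero(2)[OF a(1)] g ar_objD(2) by metis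
    then show "g = zr Z Y" by (rule epi_zeroD[OF p g])
  qed
  obtain P e where e: "is_kernel C P e B d Z" using ex_kernel_ar[OF d] by blast
  note ea = kernel_ar(1)[OF e] and se = short_exactD[OF short_exactI_epi[OF depi e]]
  have e2: "ar (p2 \<star> e) P M" and e1: "ar (p1 \<star> e) P E" using ar_comp a ea by blast+
  show thesis
  proof (rule that[of "p1 \<star> e" P "p2 \<star> e"])
    show "ar (p1 \<star> e) P E" by (fact e1)
    show "p \<star> p1 \<star> e = q \<star> p2 \<star> e" using dzero[OF ea] kernel_ar(3)[OF e] by blast
    \<comment> \<open>If \<open>g\<close> kills this leg, then \<open>g \<star> p2\<close> descends
      along \<open>d\<close> to some \<open>h\<close>. On the summand \<open>E\<close> this reads
      \<open>h \<star> p = 0\<close>, so \<open>h\<close> and then \<open>g\<close> vanish.\<close>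
    show "is_epi C P M (p2 \<star> e)"
    proof (rule epiI[OF e2])
      fix Y g assume g: "ar g M Y" and g0: "g \<star> p2 \<star> e = zr P Y"
      have Y: "Y \<in> Obj C" using g ar_objD by blast
      have "(g \<star> p2) \<star> e = zr P Y" using assoc[OF g a(4) ea] g0 by simp
      from cokernel_desc[OF se(2) ar_comp[OF g a(4)] this]
      obtain h where h: "ar h Z Y" "h \<star> d = g \<star> p2" .
      have "h \<star> p = g \<star> p2 \<star> i1" using assoc[OF h(1) d a(1)] assoc[OF g a(4) a(1)] di1 h(2) by simp
      also have "\<dots> = zr E Y" using b(4) comp_zero(1)[OF g obs(1)] by simp
      finally have "h = zr Z Y" by (rule epi_zeroD[OF p h(1)])
      then have "g \<star> p2 = zr B Y" using h(2) comp_zero(2)[OF d Y] by simp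
      then have "g \<star> p2 \<star> i2 = zr M Y" using assoc[OF g a(4) a(2)] comp_zero(2)[OF a(2) Y] by simp
      then show "g = zr M Y" using b(2) comp_id(1)[OF g] by simp
    qed
    fix W
    show "\<exists>h. ar h W P \<and> (p1 \<star> e) \<star> h = f \<and> (p2 \<star> e) \<star> h = g"
      if f: "ar f W E" and g: "ar g W M" and eq: "p \<star> f = q \<star> g" for f g
    proof -
      have W: "W \<in> Obj C" using f ar_objD by blast
      note ff = ar_comp[OF a(1) f] and gg = ar_comp[OF a(2) g]
      define x where "x = add_C W B (i1 \<star> f) (i2 \<star> g)"
      have x: "ar x W B" unfolding x_def by (rule ar_add[OF ff gg])
      have "p1 \<star> x = add_C W E ((p1 \<star> i1) \<star> f) ((p1 \<star> i2) \<star> g)"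
        unfolding x_def distr(1)[OF a(3) ff gg] assoc[OF a(3) a(1) f] assoc[OF a(3) a(2) g] ..
      then have x1: "p1 \<star> x = f"
        using b comp_id(2)[OF f] comp_zero(2)[OF g obs(1)] add_zero(1)[OF f] by simp
      have "p2 \<star> x = add_C W M ((p2 \<star> i1) \<star> f) ((p2 \<star> i2) \<star> g)"
        unfolding x_def distr(1)[OF a(4) ff gg] assoc[OF a(4) a(1) f] assoc[OF a(4) a(2) g] ..
      then have x2: "p2 \<star> x = g"
        using b comp_id(2)[OF g] comp_zero(2)[OF f obs(3)] add_zero(2)[OF g] by simp
      have "d \<star> x = zr W Z" using dzero[OF x] x1 x2 eq by simp
      from kernel_lift[OF e x this] obtain h where h: "ar h W P" "e \<star> h = x" .
      then show ?thesis using assoc[OF a(3) ea h(1)] assoc[OF a(4) ea h(1)] x1 x2 by auto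
    qed
    show "h = h'" if h: "ar h W P" and h': "ar h' W P" and eq1: "(p1 \<star> e) \<star> h = (p1 \<star> e) \<star> h'"
      and eq2: "(p2 \<star> e) \<star> h = (p2 \<star> e) \<star> h'" for h h'
    proof -
      have dec: "x = add_C W B (i1 \<star> p1 \<star> x) (i2 \<star> p2 \<star> x)" if x: "ar x W B" for x
        using distr(2)[OF ar_comp[OF a(1) a(3)] ar_comp[OF a(2) a(4)] x] b(5) comp_id(2)[OF x]
          assoc[OF a(1) a(3) x] assoc[OF a(2) a(4) x] by simp
      have "p1 \<star> e \<star> h = p1 \<star> e \<star> h'" "p2 \<star> e \<star> h = p2 \<star> e \<star> h'"
        using eq1 eq2 assoc[OF a(3) ea h] assoc[OF a(3) ea h'] assoc[OF a(4) ea h] assoc[OF a(4) ea h'] by auto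
      then have "e \<star> h = e \<star> h'" using dec[OF ar_comp[OF ea h]] dec[OF ar_comp[OF ea h']] by simp
      then show ?thesis by (rule monoD[OF se(3) h h'])
    qed
  qed
qed


section \<open>Split extensions and vanishing of Ext\<close>

text \<open>The idempotent \<open>s \<star> p\<close> has the complement \<open>u\<close>. Since
  \<open>p\<close> kills \<open>u\<close>, it factors through the kernel \<open>i\<close>, and the
  factor \<open>r\<close> is the missing projection.\<close>

lemma section_biproduct:
  assumes se: "short_exact C Y i E p X" and s: "ar s X E" and ps: "p \<star> s = Ident C X"
  shows "\<exists>r. is_biproduct C Y X E i s r p"
proof -
  note e = short_exactD[OF se]
  have ob: "Y \<in> Obj C" "E \<in> Obj C" "X \<in> Obj C" using e(5,6) ar_objD by auto
  note sp = ar_comp[OF s e(6)]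
  obtain u where u: "ar u E E" "add_C E E (s \<star> p) u = Ident C E" using ex_diff[OF ar_id[OF ob(2)] sp] by blast
  have psp: "p \<star> s \<star> p = p" using assoc[OF e(6) s e(6)] ps comp_id(2)[OF e(6)] by simp
  have sps: "(s \<star> p) \<star> s = s" using assoc[OF s e(6) s] ps comp_id(1)[OF s] by simp
  have spi: "(s \<star> p) \<star> i = zr Y E" using assoc[OF s e(6) e(5)] e(7) comp_zero(1)[OF s ob(1)] by simp
  have "add_C E X p (p \<star> u) = p" using distr(1)[OF e(6) sp u(1)] u(2) psp comp_id(1)[OF e(6)] by simp
  then have pu: "p \<star> u = zr E X" by (rule add_eq_self[OF e(6) ar_comp[OF e(6) u(1)]])
  obtain r where r: "ar r E Y" "i \<star> r = u" using kernel_lift[OF e(1) u(1) pu] by blast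
  have "u \<star> i = i" using distr(2)[OF sp u(1) e(5)] u(2) spi comp_id(2)[OF e(5)]
      add_zero(2)[OF ar_comp[OF u(1) e(5)]] by simp
  then have "i \<star> r \<star> i = i \<star> Ident C Y" using assoc[OF e(5) r(1) e(5)] r(2) comp_id(1)[OF e(5)] by simp
  then have ri: "r \<star> i = Ident C Y"
    by (rule monoD[OF e(3) ar_comp[OF r(1) e(5)] ar_id[OF ob(1)]])
  have "add_C X E s (u \<star> s) = s" using distr(2)[OF sp u(1) s] u(2) sps comp_id(2)[OF s] by simp
  then have "u \<star> s = zr X E" by (rule add_eq_self[OF s ar_comp[OF u(1) s]])
  then have "i \<star> r \<star> s = zr X E" using assoc[OF e(5) r(1) s] r(2) by simp
  then have rs: "r \<star> s = zr X Y" by (rule mono_zeroD[OF e(3) ar_comp[OF r(1) s]])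
  have "add_C E E (i \<star> r) (s \<star> p) = Ident C E" using u(2) add_comm[OF sp u(1)] r(2) by simp
  then show ?thesis using ri rs ps e(5-7) s r(1) ob unfolding is_biproduct_def arrow_def by blast
qed

text \<open>Decomposing the identity of \<open>E\<close> shows that an arrow \<open>g\<close> killed
  by \<open>p\<close> equals \<open>i \<star> r \<star> g\<close>.\<close>

lemma biproduct_short_exact:
  assumes "is_biproduct C Y X E i s r p"
  shows "short_exact C Y i E p X"
proof -
  have a: "ar i Y E" "ar s X E" "ar r E Y" "ar p E X" and ob: "Y \<in> Obj C" "X \<in> Obj C"
    and b: "r \<star> i = Ident C Y" "p \<star> s = Ident C X" "r \<star> s = zr X Y" "p \<star> i = zr Y X"
      "add_C E E (i \<star> r) (s \<star> p) = Ident C E"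
    using assms by (auto simp: is_biproduct_def arrow_def)
  have "is_epi C E X p"
  proof (rule epiI[OF a(4)])
    fix Z g assume g: "ar g X Z" "g \<star> p = zr E Z"
    then show "g = zr X Z"
      using assoc[OF g(1) a(4,2)] b(2) comp_id(1)[OF g(1)] comp_zero(2)[OF a(2)] ar_objD(2) by metis
  qed
  moreover have "is_kernel C Y i E p X"
  proof (rule kernelI[OF _ a(4) b(4)])
    show "is_mono C Y E i"
    proof (rule monoI[OF a(1)])
      fix W g assume g: "ar g W Y" "i \<star> g = zr W E"
      then show "g = zr W Y"
        using assoc[OF a(3,1) g(1)] b(1) comp_id(2)[OF g(1)] comp_zero(1)[OF a(3)] ar_objD(1) by metis
    qed
    fix W g assume g: "ar g W E" "p \<star> g = zr W X"
    have W: "W \<in> Obj C" using g ar_objD by blast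
    have "g = add_C W E ((i \<star> r) \<star> g) ((s \<star> p) \<star> g)"
      using distr(2)[OF ar_comp[OF a(1,3)] ar_comp[OF a(2,4)] g(1)] b(5) comp_id(2)[OF g(1)] by simp
    also have "\<dots> = i \<star> r \<star> g"
      using assoc[OF a(2,4) g(1)] assoc[OF a(1,3) g(1)] g(2) comp_zero(1)[OF a(2) W]
        add_zero(1)[OF ar_comp[OF a(1) ar_comp[OF a(3) g(1)]]] by simp
    finally show "\<exists>h. ar h W Y \<and> i \<star> h = g" using ar_comp[OF a(3) g(1)] by metis
  qed
  ultimately show ?thesis by (rule short_exactI_epi)
qed

text \<open>Sending each summand of \<open>E\<close> to its counterpart in \<open>E'\<close> is an
  isomorphism of extensions, so all split extensions form a single class.\<close>

lemma biproduct_ext_equiv: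
  assumes B: "is_biproduct C Y X E i s r p" and B': "is_biproduct C Y X E' i' s' r' p'"
  shows "((E, i, p), (E', i', p')) \<in> ext_equiv C X Y"
proof -
  have a: "ar i Y E" "ar s X E" "ar r E Y" "ar p E X" and ob: "Y \<in> Obj C" "X \<in> Obj C"
    and b: "r \<star> i = Ident C Y" "p \<star> s = Ident C X" "r \<star> s = zr X Y" "p \<star> i = zr Y X"
      "add_C E E (i \<star> r) (s \<star> p) = Ident C E"
    using B by (auto simp: is_biproduct_def arrow_def)
  have a': "ar i' Y E'" "ar s' X E'" "ar r' E' Y" "ar p' E' X"
    and b': "r' \<star> i' = Ident C Y" "p' \<star> s' = Ident C X" "r' \<star> s' = zr X Y" "p' \<star> i' = zr Y X"
      "add_C E' E' (i' \<star> r') (s' \<star> p') = Ident C E'"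
    using B' by (auto simp: is_biproduct_def arrow_def)
  have EO: "E \<in> Obj C" "E' \<in> Obj C" using a a' ar_objD by auto
  define h where "h = add_C E E' (i' \<star> r) (s' \<star> p)"
  define g where "g = add_C E' E (i \<star> r') (s \<star> p')"
  note ir = ar_comp[OF a'(1) a(3)] and sp = ar_comp[OF a'(2) a(4)]
  note ir' = ar_comp[OF a(1) a'(3)] and sp' = ar_comp[OF a(2) a'(4)]
  have h: "ar h E E'" unfolding h_def by (rule ar_add[OF ir sp])
  have g: "ar g E' E" unfolding g_def by (rule ar_add[OF ir' sp'])
  have hi: "h \<star> i = i'" unfolding h_def distr(2)[OF ir sp a(1)]
    using assoc[OF a'(1) a(3,1)] assoc[OF a'(2) a(4,1)] b comp_id(1)[OF a'(1)]
      comp_zero(1)[OF a'(2) ob(1)] add_zero(1)[OF a'(1)] by simp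
  have hs: "h \<star> s = s'" unfolding h_def distr(2)[OF ir sp a(2)]
    using assoc[OF a'(1) a(3,2)] assoc[OF a'(2) a(4,2)] b comp_id(1)[OF a'(2)]
      comp_zero(1)[OF a'(1) ob(2)] add_zero(2)[OF a'(2)] by simp
  have gi: "g \<star> i' = i" unfolding g_def distr(2)[OF ir' sp' a'(1)]
    using assoc[OF a(1) a'(3,1)] assoc[OF a(2) a'(4,1)] b' comp_id(1)[OF a(1)]
      comp_zero(1)[OF a(2) ob(1)] add_zero(1)[OF a(1)] by simp
  have gs: "g \<star> s' = s" unfolding g_def distr(2)[OF ir' sp' a'(2)]
    using assoc[OF a(1) a'(3,2)] assoc[OF a(2) a'(4,2)] b' comp_id(1)[OF a(2)]
      comp_zero(1)[OF a(1) ob(2)] add_zero(2)[OF a(2)] by simp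
  have ph: "p' \<star> h = p" unfolding h_def distr(1)[OF a'(4) ir sp]
    using assoc[OF a'(4,1) a(3)] assoc[OF a'(4,2) a(4)] b' comp_id(2)[OF a(4)]
      comp_zero(2)[OF a(3) ob(2)] add_zero(2)[OF a(4)] by simp
  have "g \<star> h = add_C E E ((g \<star> i') \<star> r) ((g \<star> s') \<star> p)"
    unfolding h_def distr(1)[OF g ir sp] assoc[OF g a'(1) a(3)] assoc[OF g a'(2) a(4)] ..
  then have gh: "g \<star> h = Ident C E" using gi gs b(5) by simp
  have "h \<star> g = add_C E' E' ((h \<star> i) \<star> r') ((h \<star> s) \<star> p')"
    unfolding g_def distr(1)[OF h ir' sp'] assoc[OF h a(1) a'(3)] assoc[OF h a(2) a'(4)] ..
  then have "h \<star> g = Ident C E'" using hi hs b'(5) by simp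
  from isoI[OF h g gh this] hi ph show ?thesis
    using biproduct_short_exact[OF B] biproduct_short_exact[OF B']
    unfolding ext_equiv_def Defs.extensions_def by (auto intro: exI[of _ h])
qed

text \<open>Each extension belongs to its own class, through the identity, and the only class
  present consists of biproducts.\<close>

lemma Ext1_vanishes_imp_all_split:
  assumes v: "Ext1_vanishes C X Y"
  shows "all_split C X Y"
  unfolding all_split_def
proof (intro allI impI)
  fix E i p assume se: "short_exact C Y i E p X"
  have EO: "E \<in> Obj C" using short_exactD(5)[OF se] ar_objD by blast
  have x: "(E, i, p) \<in> Defs.extensions C X Y" using se by (simp add: Defs.extensions_def)
  have "is_iso C E E (Ident C E)" by (rule isoI) (use EO ar_id comp_id in auto)
  then have "((E, i, p), (E, i, p)) \<in> ext_equiv C X Y"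
    using x comp_id(2)[OF short_exactD(5)[OF se]] comp_id(1)[OF short_exactD(6)[OF se]]
    unfolding ext_equiv_def by blast
  moreover have "ext_equiv C X Y `` {(E, i, p)} = Ext1_zero C X Y"
    using v quotientI[OF x, of "ext_equiv C X Y"] unfolding Ext1_vanishes_def Ext1_def by simp
  ultimately have "(E, i, p) \<in> Ext1_zero C X Y" by blast
  then show "\<exists>s \<in> arr C X E. p \<star> s = Ident C X"
    unfolding Ext1_zero_def is_biproduct_def by blast
qed

text \<open>Once all extensions split, any two are equivalent and \<open>Ext1_zero\<close> is the
  set of all of them.\<close>

lemma all_split_imp_Ext1_vanishes:
  assumes ob: "X \<in> Obj C" "Y \<in> Obj C" and sp: "all_split C X Y"
  shows "Ext1_vanishes C X Y"
proof -
  have bi: "\<exists>r s. is_biproduct C Y X E i s r p" if se: "short_exact C Y i E p X" for E i p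
  proof -
    obtain s where "s \<in> arr C X E" "p \<star> s = Ident C X" using sp se unfolding all_split_def by blast
    then show ?thesis using section_biproduct[OF se] short_exactD(5)[OF se] ob by (auto simp: arrow_def)
  qed
  have z: "Ext1_zero C X Y = Defs.extensions C X Y" using bi unfolding Ext1_zero_def Defs.extensions_def by blast
  have "ext_equiv C X Y `` {x} = Defs.extensions C X Y" if x: "x \<in> Defs.extensions C X Y" for x
  proof
    show "ext_equiv C X Y `` {x} \<subseteq> Defs.extensions C X Y" by (auto simp: ext_equiv_def)
    show "Defs.extensions C X Y \<subseteq> ext_equiv C X Y `` {x}"
    proof
      fix y assume "y \<in> Defs.extensions C X Y"
      then obtain E i p E' i' p' where xy: "x = (E, i, p)" "y = (E', i', p')"
        "short_exact C Y i E p X" "short_exact C Y i' E' p' X"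
        using x unfolding Defs.extensions_def by blast
      then show "y \<in> ext_equiv C X Y `` {x}" using bi[OF xy(3)] bi[OF xy(4)] biproduct_ext_equiv by blast
    qed
  qed
  \<comment> \<open>The biproduct is an extension. Without one, the quotient would be empty instead
    of a singleton.\<close>
  moreover have "Defs.extensions C X Y \<noteq> {}"
  proof -
    obtain P i1 i2 p1 p2 where "is_biproduct C Y X P i1 i2 p1 p2" using ex_biproduct ob by metis
    then show ?thesis using biproduct_short_exact unfolding Defs.extensions_def by blast
  qed
  ultimately have "Defs.extensions C X Y // ext_equiv C X Y = {Defs.extensions C X Y}"
    unfolding quotient_def by blast
  then show "Ext1_vanishes C X Y" unfolding Ext1_vanishes_def Ext1_def z .
qed

section \<open>Passing split extensions to a quotient\<close>

lemma Hom_vanishesI: "\<lbrakk>X \<in> Obj C; Y \<in> Obj C; \<And>f. ar f X Y \<Longrightarrow> f = zr X Y\<rbrakk> \<Longrightarrow> Hom_vanishes C X Y"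
  using ar_zero[of X Y] unfolding Hom_vanishes_def arrow_def by blast

lemma Hom_vanishesD: "\<lbrakk>Hom_vanishes C X Y; ar f X Y\<rbrakk> \<Longrightarrow> f = zr X Y"
  by (auto simp: Hom_vanishes_def arrow_def)

text \<open>This is the injectivity of \<open>Ext\<^sup>1(W, V) \<rightarrow> Ext\<^sup>1(M, V)\<close> in the long exact sequence.\<close>

lemma all_split_quotient:
  assumes se: "short_exact C t i M q W" and split: "all_split C M V" and hv: "Hom_vanishes C t V"
  shows "all_split C W V"
  unfolding all_split_def
proof (intro allI impI)
  fix E a p assume ex: "short_exact C V a E p W"
  note e = short_exactD[OF se] and x = short_exactD[OF ex]
  have ob: "V \<in> Obj C" "M \<in> Obj C" "W \<in> Obj C" "t \<in> Obj C" using e(5,6) x(5) ar_objD by auto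
  obtain P e1 e2 where P: "ar e1 P E" "is_epi C P M e2" "p \<star> e1 = q \<star> e2"
    and univ: "\<And>U f g. \<lbrakk>ar f U E; ar g U M; p \<star> f = q \<star> g\<rbrakk> \<Longrightarrow> \<exists>h. ar h U P \<and> e1 \<star> h = f \<and> e2 \<star> h = g"
    and uniq: "\<And>U h h'. \<lbrakk>ar h U P; ar h' U P; e1 \<star> h = e1 \<star> h'; e2 \<star> h = e2 \<star> h'\<rbrakk> \<Longrightarrow> h = h'"
    by (rule epi_pullback[OF x(4) e(6)], rule that) assumption+
  note e2 = epi_ar[OF P(2)]
  \<comment> \<open>The kernel of the pulled-back projection \<open>e2\<close> is again
    \<open>V\<close>, embedded by the pair of \<open>a\<close> and zero.\<close>
  have "p \<star> a = q \<star> zr V M" using x(7) comp_zero(1)[OF e(6) ob(1)] by simp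
  from univ[OF x(5) ar_zero[OF ob(1,2)] this]
  obtain b where b: "ar b V P" "e1 \<star> b = a" "e2 \<star> b = zr V M" by blast
  have "is_kernel C V b P e2 M"
  proof (rule kernelI[OF _ e2 b(3)])
    show "is_mono C V P b"
    proof (rule monoI[OF b(1)])
      fix U g assume g: "ar g U V" "b \<star> g = zr U P"
      then have "a \<star> g = zr U E" using assoc[OF P(1) b(1) g(1)] b(2) comp_zero(1)[OF P(1)] ar_objD(1) by metis
      then show "g = zr U V" by (rule mono_zeroD[OF x(3) g(1)])
    qed
    fix U g assume g: "ar g U P" "e2 \<star> g = zr U M"
    have U: "U \<in> Obj C" using g ar_objD by blast
    have "p \<star> e1 \<star> g = zr U W"
      using assoc[OF x(6) P(1) g(1)] assoc[OF e(6) e2 g(1)] P(3) g(2) comp_zero(1)[OF e(6) U] by simp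
    from kernel_lift[OF x(1) ar_comp[OF P(1) g(1)] this] obtain h where h: "ar h U V" "a \<star> h = e1 \<star> g" .
    have "b \<star> h = g"
    proof (rule uniq[OF ar_comp[OF b(1) h(1)] g(1)])
      show "e1 \<star> b \<star> h = e1 \<star> g" using assoc[OF P(1) b(1) h(1)] b(2) h(2) by simp
      show "e2 \<star> b \<star> h = e2 \<star> g" using assoc[OF e2 b(1) h(1)] b(3) g(2) comp_zero(2)[OF h(1) ob(2)] by simp
    qed
    then show "\<exists>h. ar h U V \<and> b \<star> h = g" using h(1) by blast
  qed
  from short_exactI_epi[OF P(2) this] split
  obtain s where s: "ar s M P" "e2 \<star> s = Ident C M"
    unfolding all_split_def using ob ar_objD(2)[OF b(1)] unfolding arrow_def by blast
  \<comment> \<open>The section of the pulled-back extension amounts to a lift of \<open>q\<close>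
    along \<open>p\<close>.\<close>
  define s1 where "s1 = e1 \<star> s"
  have s1: "ar s1 M E" unfolding s1_def by (rule ar_comp[OF P(1) s(1)])
  have ps1: "p \<star> s1 = q" unfolding s1_def
    using assoc[OF x(6) P(1) s(1)] assoc[OF e(6) e2 s(1)] P(3) s(2) comp_id(1)[OF e(6)] by simp
  \<comment> \<open>On \<open>t\<close> this lift lands in \<open>V\<close>, where it must vanish.
    Hence it descends from \<open>M\<close> to \<open>W\<close>, giving the section.\<close>
  have "p \<star> s1 \<star> i = zr t W" using assoc[OF x(6) s1 e(5)] ps1 e(7) by simp
  from kernel_lift[OF x(1) ar_comp[OF s1 e(5)] this] obtain h where h: "ar h t V" "a \<star> h = s1 \<star> i" .
  then have "s1 \<star> i = zr t E" using Hom_vanishesD[OF hv h(1)] comp_zero(1)[OF x(5) ob(4)] by simp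
  from cokernel_desc[OF e(2) s1 this] obtain s' where s': "ar s' W E" "s' \<star> q = s1" .
  have "(p \<star> s') \<star> q = Ident C W \<star> q" using assoc[OF x(6) s'(1) e(6)] s'(2) ps1 comp_id(2)[OF e(6)] by simp
  from epiD[OF e(4) ar_comp[OF x(6) s'(1)] ar_id[OF ob(3)] this]
  show "\<exists>s \<in> arr C W E. p \<star> s = Ident C W" using s'(1) by (auto simp: arrow_def)
qed

section \<open>Torsion pairs and chains of them\<close>

lemma torsion_pairD:
  assumes "torsion_pair C T F"
  shows "T \<subseteq> Obj C" "F \<subseteq> Obj C" "iso_closed C T" "iso_closed C F"
    "\<And>X Y. \<lbrakk>X \<in> T; Y \<in> F\<rbrakk> \<Longrightarrow> Hom_vanishes C X Y"
    "\<And>M. M \<in> Obj C \<Longrightarrow> \<exists>X \<in> T. \<exists>Z \<in> F. \<exists>i p. short_exact C X i M p Z"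
  using assms by (auto simp: torsion_pair_def)

text \<open>The projection of \<open>X\<close> onto its torsion-free part is both zero and epi. So
  that part is zero and \<open>X\<close> is isomorphic to its torsion part.\<close>

lemma torsion_memI:
  assumes tp: "torsion_pair C T F" and X: "X \<in> Obj C" and hv: "\<And>Y. Y \<in> F \<Longrightarrow> Hom_vanishes C X Y"
  shows "X \<in> T"
proof -
  obtain t f i p where *: "t \<in> T" "f \<in> F" "short_exact C t i X p f" using torsion_pairD(6)[OF tp X] by blast
  note e = short_exactD[OF *(3)]
  have p0: "p = zr X f" using Hom_vanishesD[OF hv[OF *(2)] e(6)] .
  have f: "f \<in> Obj C" using e(6) ar_objD by blast
  have "Ident C f = zr f f"
    using epi_zeroD[OF e(4) ar_id[OF f]] comp_id(2)[OF e(6)] p0 by simp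
  then have "is_zero C f" using is_zero_iff f by simp
  then show ?thesis using short_exact_right_zero_iso[OF *(3)] torsion_pairD(3)[OF tp] *(1)
    unfolding iso_closed_def by blast
qed

text \<open>
  The torsion-free quotients of \<open>N\<close> form a chain of quotients; the sequence required is the one whose
  torsion-free part has least length.
\<close>

lemma chain_torsion_sequence:
  assumes L: "length_function C L" and J: "J \<noteq> {}"
    and tp: "\<And>j. j \<in> J \<Longrightarrow> torsion_pair C (T j) (F j)"
    and chain: "\<And>i j. \<lbrakk>i \<in> J; j \<in> J\<rbrakk> \<Longrightarrow> T i \<subseteq> T j \<or> F i \<subseteq> F j"
    and N: "N \<in> Obj C"
  shows "\<exists>j \<in> J. \<exists>t i p f. short_exact C t i N p f \<and> t \<in> T j \<and> f \<in> (\<Inter>j \<in> J. F j)"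
proof -
  have ind: ?thesis if "j \<in> J" "L n f" "short_exact C t i N p f" "t \<in> T j" "f \<in> F j" for n j t i p f
    using that
  proof (induction n arbitrary: j t i p f rule: less_induct)
    case (less n)
    show ?case
    proof (cases "f \<in> (\<Inter>j \<in> J. F j)")
      case True
      then show ?thesis using less.prems by blast
    next
      case False
      then obtain l where l: "l \<in> J" "f \<notin> F l" by blast
      \<comment> \<open>\<open>f\<close> lies in \<open>F j\<close> but not in \<open>F l\<close>,
        so comparability leaves only this inclusion. It makes \<open>p'\<close> vanish on
        \<open>t\<close> and thus factor through \<open>p\<close>.\<close>
      then have sub: "T j \<subseteq> T l" using chain less.prems by blast
      obtain t' i' p' f' where s': "short_exact C t' i' N p' f'" "t' \<in> T l" "f' \<in> F l"
        using torsion_pairD(6)[OF tp[OF l(1)] N] by blast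
      note e = short_exactD[OF less.prems(3)] and e' = short_exactD[OF s'(1)]
      have "p' \<star> i = zr t f'"
        using Hom_vanishesD[OF torsion_pairD(5)[OF tp[OF l(1)], of t f'] ar_comp[OF e'(6) e(5)]]
          sub less.prems(4) s'(3) by blast
      from cokernel_desc[OF e(2) e'(6) this] obtain h where h: "ar h f f'" "h \<star> p = p'" .
      have "is_epi C f f' h"
      proof (rule epiI[OF h(1)])
        fix Y g assume g: "ar g f' Y" "g \<star> h = zr f Y"
        have "g \<star> p' = zr N Y"
          using assoc[OF g(1) h(1) e(6)] h(2) g comp_zero(2)[OF e(6)] ar_objD(2) by metis
        then show "g = zr f' Y" by (rule epi_zeroD[OF e'(4) g(1)])
      qed
      moreover obtain Q k where "is_kernel C Q k f h f'" using ex_kernel_ar[OF h(1)] by blast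
      ultimately have se: "short_exact C Q k f h f'" by (rule short_exactI_epi)
      then obtain a b where ab: "a + b = n" "L a Q" "L b f'"
        using L less.prems(2) unfolding length_function_def by metis
      \<comment> \<open>Otherwise \<open>f\<close> would be isomorphic to \<open>f'\<close> and lie
        in \<open>F l\<close>. A non-zero kernel has positive length, so passing from
        \<open>f\<close> to \<open>f'\<close> lowers the length strictly.\<close>
      have "\<not> is_zero C Q"
      proof
        assume "is_zero C Q"
        from short_exact_left_zero_iso[OF se this] show False
          using torsion_pairD(4)[OF tp[OF l(1)]] s'(3) l(2) unfolding iso_closed_def by blast
      qed
      then have "b < n" using ab L unfolding length_function_def by (cases a) auto
      then show ?thesis using less.IH[OF _ l(1) ab(3) s'] by blast
    qed
  qed
  obtain j where j: "j \<in> J" using J by blast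
  obtain t i p f where s: "short_exact C t i N p f" "t \<in> T j" "f \<in> F j"
    using torsion_pairD(6)[OF tp[OF j] N] by blast
  have "f \<in> Obj C" using torsion_pairD(2)[OF tp[OF j]] s(3) by blast
  then obtain n where "L n f" using L unfolding length_function_def by blast
  from ind[OF j this s] show ?thesis .
qed


section \<open>Additivity of composition length\<close>

text \<open>The image of \<open>f\<close>, formed as the kernel of its cokernel, is a non-zero
  subobject of \<open>S\<close>, hence all of \<open>S\<close>. So the cokernel map is zero.\<close>

lemma nonzero_to_simple_epi:
  assumes S: "is_simple C S" and f: "ar f A S" and nz: "f \<noteq> zr A S"
  shows "is_epi C A S f"
proof -
  obtain Q c where c: "is_cokernel C A f S c Q" using ex_cokernel_ar[OF f] by blast
  note ca = cokernel_ar[OF c]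
  obtain I m where m: "is_kernel C I m S c Q" using ex_kernel_ar[OF ca(2)] by blast
  note ma = kernel_ar[OF m]
  obtain f' where f': "ar f' A I" "m \<star> f' = f" using kernel_lift[OF m f ca(3)] by blast
  have A: "A \<in> Obj C" using f ar_objD by blast
  have "\<not> is_zero C I"
  proof
    assume "is_zero C I"
    then have "f' = zr A I" using is_zero_ar_unique(1) f'(1) by blast
    then show False using nz f'(2) comp_zero(1)[OF ma(1) A] by simp
  qed
  then have "is_iso C I S m" using S kernel_mono[OF m] unfolding is_simple_def by blast
  then obtain n where n: "ar n S I" "m \<star> n = Ident C S" using isoE by metis
  have c0: "c = zr S Q"
    using assoc[OF ca(2) ma(1) n(1)] n(2) ma(3) comp_id(1)[OF ca(2)] comp_zero(2)[OF n(1)] ar_objD(2)[OF ca(2)]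
    by simp
  show ?thesis
  proof (rule epiI[OF f])
    fix Z g assume g: "ar g S Z" "g \<star> f = zr A Z"
    from cokernel_desc[OF c g] obtain h where h: "ar h Q Z" "h \<star> c = g" .
    then show "g = zr S Z" using c0 comp_zero(1)[OF h(1)] ar_objD(1)[OF ca(2)] by simp
  qed
qed

text \<open>The top factor \<open>S\<close> of \<open>M\<close> belongs to \<open>B\<close> if
  \<open>A\<close> maps to zero in \<open>S\<close>, and to \<open>A\<close> otherwise. The
  remaining factors are handled by a short exact sequence with middle term \<open>X\<close>.\<close>

lemma comp_length_short_exact:
  assumes "comp_length C n M" "short_exact C A a M b B"
  shows "\<exists>k l. k + l = n \<and> comp_length C k A \<and> comp_length C l B"
  using assms
proof (induction arbitrary: A a b B)
  case (zero M)
  note e = short_exactD[OF zero(2)]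
  have ob: "A \<in> Obj C" "B \<in> Obj C" using e ar_objD by auto
  have "Ident C A = zr A A"
    using mono_zeroD[OF e(3) ar_id[OF ob(1)]] comp_id(1)[OF e(5)] is_zero_ar_unique(1)[OF zero(1) e(5)] by simp
  moreover have "Ident C B = zr B B"
    using epi_zeroD[OF e(4) ar_id[OF ob(2)]] comp_id(2)[OF e(6)] is_zero_ar_unique(2)[OF zero(1) e(6)] by simp
  ultimately show ?case using comp_length.zero is_zero_iff ob by (metis add_0)
next
  case (step n X x M q S)
  note e = short_exactD[OF step.prems] and s = short_exactD[OF step.hyps(2)]
  have ob: "A \<in> Obj C" "B \<in> Obj C" "M \<in> Obj C" "X \<in> Obj C" "S \<in> Obj C"
    using e(5,6) s(5,6) ar_objD by auto
  note qa = ar_comp[OF s(6) e(5)] and bx = ar_comp[OF e(6) s(5)]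
  show ?case
  proof (cases "q \<star> a = zr A S")
    case True
    from kernel_lift[OF s(1) e(5) True] obtain a' where a': "ar a' A X" "x \<star> a' = a" .
    \<comment> \<open>The kernel \<open>D\<close> of \<open>c\<close> is the image of
      \<open>X\<close> in \<open>B\<close>, and \<open>A\<close>, \<open>X\<close>, \<open>D\<close>
      will form the sequence for the induction hypothesis.\<close>
    from cokernel_desc[OF e(2) s(6) True] obtain c where c: "ar c B S" "c \<star> b = q" .
    have cepi: "is_epi C B S c"
    proof (rule epiI[OF c(1)])
      fix Z g assume g: "ar g S Z" "g \<star> c = zr B Z"
      have "g \<star> q = zr M Z"
        using assoc[OF g(1) c(1) e(6)] c(2) g comp_zero(2)[OF e(6)] ar_objD(2) by metis
      then show "g = zr S Z" by (rule epi_zeroD[OF s(4) g(1)])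
    qed
    obtain D d where d: "is_kernel C D d B c S" using ex_kernel_ar[OF c(1)] by blast
    have seD: "short_exact C D d B c S" by (rule short_exactI_epi[OF cepi d])
    note da = short_exactD[OF seD]
    have "c \<star> b \<star> x = zr X S" using assoc[OF c(1) e(6) s(5)] c(2) s(7) by simp
    from kernel_lift[OF d bx this] obtain h where h: "ar h X D" "d \<star> h = b \<star> x" .
    \<comment> \<open>Surjectivity of \<open>h\<close> is tested after pulling \<open>b\<close> back
      along \<open>d\<close>: the leg \<open>f\<close> into \<open>M\<close> is killed by
      \<open>q\<close>, so it lifts to \<open>X\<close>.\<close>
    obtain P f g where P: "ar f P M" "is_epi C P D g" "b \<star> f = d \<star> g"
      by (rule epi_pullback[OF e(4) da(5)], rule that) assumption+
    note g = epi_ar[OF P(2)]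
    have "q \<star> f = zr P S"
      using assoc[OF c(1) e(6) P(1)] assoc[OF c(1) da(5) g] c(2) P(3) da(7) comp_zero(2)[OF g ob(5)] by simp
    from kernel_lift[OF s(1) P(1) this] obtain f' where f': "ar f' P X" "x \<star> f' = f" .
    have "d \<star> h \<star> f' = d \<star> g"
      using assoc[OF da(5) h(1) f'(1)] assoc[OF e(6) s(5) f'(1)] h(2) f'(2) P(3) by simp
    from monoD[OF da(3) ar_comp[OF h(1) f'(1)] g this] have hf: "h \<star> f' = g" .
    have "is_epi C X D h"
    proof (rule epiI[OF h(1)])
      fix Z y assume y: "ar y D Z" "y \<star> h = zr X Z"
      have "y \<star> g = zr P Z"
        using assoc[OF y(1) h(1) f'(1)] hf y comp_zero(2)[OF f'(1)] ar_objD(2) by metis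
      then show "y = zr D Z" by (rule epi_zeroD[OF P(2) y(1)])
    qed
    moreover have "is_kernel C A a' X h D"
    proof (rule kernelI[OF _ h(1)])
      show "is_mono C A X a'"
      proof (rule monoI[OF a'(1)])
        fix W y assume y: "ar y W A" "a' \<star> y = zr W X"
        have "a \<star> y = zr W M"
          using assoc[OF s(5) a'(1) y(1)] a'(2) y comp_zero(1)[OF s(5)] ar_objD(1) by metis
        then show "y = zr W A" by (rule mono_zeroD[OF e(3) y(1)])
      qed
      have "d \<star> h \<star> a' = zr A B"
        using assoc[OF da(5) h(1) a'(1)] assoc[OF e(6) s(5) a'(1)] h(2) a'(2) e(7) by simp
      then show "h \<star> a' = zr A D" by (rule mono_zeroD[OF da(3) ar_comp[OF h(1) a'(1)]])
      fix W y assume y: "ar y W X" "h \<star> y = zr W D"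
      have W: "W \<in> Obj C" using y ar_objD by blast
      have "b \<star> x \<star> y = zr W B"
        using assoc[OF e(6) s(5) y(1)] assoc[OF da(5) h(1) y(1)] h(2) y(2) comp_zero(1)[OF da(5) W] by simp
      from kernel_lift[OF e(1) ar_comp[OF s(5) y(1)] this] obtain w where w: "ar w W A" "a \<star> w = x \<star> y" .
      have "x \<star> a' \<star> w = x \<star> y" using assoc[OF s(5) a'(1) w(1)] a'(2) w(2) by simp
      from monoD[OF s(3) ar_comp[OF a'(1) w(1)] y(1) this]
      show "\<exists>w. ar w W A \<and> a' \<star> w = y" using w(1) by blast
    qed
    ultimately have "short_exact C A a' X h D" by (rule short_exactI_epi)
    from step.IH[OF this] obtain k l where "k + l = n" "comp_length C k A" "comp_length C l D" by blast
    then show ?thesis using comp_length.step[OF _ seD step.hyps(3)] by (metis add_Suc_right)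
  next
    case False
    have qepi: "is_epi C A S (q \<star> a)" by (rule nonzero_to_simple_epi[OF step.hyps(3) qa False])
    \<comment> \<open>\<open>U\<close> is the intersection of \<open>A\<close> and \<open>X\<close>
      in \<open>M\<close>, and \<open>U\<close>, \<open>X\<close>, \<open>B\<close> will form the
      sequence for the induction hypothesis.\<close>
    obtain U u where u: "is_kernel C U u A (q \<star> a) S" using ex_kernel_ar[OF qa] by blast
    have seU: "short_exact C U u A (q \<star> a) S" by (rule short_exactI_epi[OF qepi u])
    note ua = short_exactD[OF seU]
    have "q \<star> a \<star> u = zr U S" using assoc[OF s(6) e(5) ua(5)] ua(7) by simp
    from kernel_lift[OF s(1) ar_comp[OF e(5) ua(5)] this] obtain v where v: "ar v U X" "x \<star> v = a \<star> u" .
    \<comment> \<open>\<open>A\<close> already covers \<open>S\<close>, so the map \<open>h\<close>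
      induced on \<open>S\<close> vanishes on composing with \<open>q \<star> a\<close>.\<close>
    have "is_epi C X B (b \<star> x)"
    proof (rule epiI[OF bx])
      fix Z y assume y: "ar y B Z" "y \<star> b \<star> x = zr X Z"
      have Z: "Z \<in> Obj C" using y ar_objD by blast
      have "(y \<star> b) \<star> x = zr X Z" using assoc[OF y(1) e(6) s(5)] y(2) by simp
      from cokernel_desc[OF s(2) ar_comp[OF y(1) e(6)] this] obtain h where h: "ar h S Z" "h \<star> q = y \<star> b" .
      have "h \<star> q \<star> a = zr A Z"
        using assoc[OF h(1) s(6) e(5)] assoc[OF y(1) e(6,5)] h(2) e(7) comp_zero(1)[OF y(1) ob(1)] by simp
      then have "h = zr S Z" by (rule epi_zeroD[OF qepi h(1)])
      then have "y \<star> b = zr M Z" using h(2) comp_zero(2)[OF s(6) Z] by simp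
      then show "y = zr B Z" by (rule epi_zeroD[OF e(4) y(1)])
    qed
    moreover have "is_kernel C U v X (b \<star> x) B"
    proof (rule kernelI[OF _ bx])
      show "is_mono C U X v"
      proof (rule monoI[OF v(1)])
        fix W y assume y: "ar y W U" "v \<star> y = zr W X"
        have W: "W \<in> Obj C" using y ar_objD by blast
        have "a \<star> u \<star> y = zr W M"
          using assoc[OF s(5) v(1) y(1)] assoc[OF e(5) ua(5) y(1)] v(2) y(2) comp_zero(1)[OF s(5) W] by simp
        then have "u \<star> y = zr W A" by (rule mono_zeroD[OF e(3) ar_comp[OF ua(5) y(1)]])
        then show "y = zr W U" by (rule mono_zeroD[OF ua(3) y(1)])
      qed
      have "U \<in> Obj C" using v ar_objD by blast
      then show "(b \<star> x) \<star> v = zr U B"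
        using assoc[OF e(6) s(5) v(1)] assoc[OF e(6,5) ua(5)] v(2) e(7) comp_zero(2)[OF ua(5) ob(2)] by simp
      fix W y assume y: "ar y W X" "(b \<star> x) \<star> y = zr W B"
      have W: "W \<in> Obj C" using y ar_objD by blast
      have "b \<star> x \<star> y = zr W B" using assoc[OF e(6) s(5) y(1)] y(2) by simp
      from kernel_lift[OF e(1) ar_comp[OF s(5) y(1)] this] obtain w where w: "ar w W A" "a \<star> w = x \<star> y" .
      have "(q \<star> a) \<star> w = zr W S"
        using assoc[OF s(6) e(5) w(1)] assoc[OF s(6,5) y(1)] w(2) s(7) comp_zero(2)[OF y(1) ob(5)] by simp
      from kernel_lift[OF ua(1) w(1) this] obtain w' where w': "ar w' W U" "u \<star> w' = w" .
      have "x \<star> v \<star> w' = x \<star> y"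
        using assoc[OF s(5) v(1) w'(1)] assoc[OF e(5) ua(5) w'(1)] v(2) w'(2) w(2) by simp
      from monoD[OF s(3) ar_comp[OF v(1) w'(1)] y(1) this]
      show "\<exists>w. ar w W U \<and> v \<star> w = y" using w'(1) by blast
    qed
    ultimately have "short_exact C U v X (b \<star> x) B" by (rule short_exactI_epi)
    from step.IH[OF this] obtain k l where "k + l = n" "comp_length C k U" "comp_length C l B" by blast
    then show ?thesis using comp_length.step[OF _ seU step.hyps(3)] by (metis add_Suc)
  qed
qed

lemma finite_length_comp_length: "finite_length C M \<Longrightarrow> \<exists>n. comp_length C n M"
  by (induction rule: finite_length.induct) (blast intro: comp_length.intros)+

lemma length_function_comp_length:
  assumes "\<And>M. M \<in> Obj C \<Longrightarrow> finite_length C M"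
  shows "length_function C (comp_length C)"
  unfolding length_function_def
  using assms finite_length_comp_length comp_length_short_exact
  by (auto elim: comp_length.cases)

section \<open>Torsion-free quotients of a graded object\<close>

text \<open>The order, the length relation and the families \<open>A\<close>, \<open>Om\<close> are
  parameters so that the same statement serves the category and its opposite with the order
  reversed.\<close>

lemma torsion_free_quotients:
  fixes lt :: "'g \<Rightarrow> 'g \<Rightarrow> bool" and T F :: "'g \<Rightarrow> 'o set" and M :: "'g \<Rightarrow> 'o"
  assumes L: "length_function C L"
    and tp: "\<And>k. k \<in> G \<Longrightarrow> torsion_pair C (T k) (F k)"
    and total: "\<And>k l. \<lbrakk>k \<in> G; l \<in> G\<rbrakk> \<Longrightarrow> lt k l \<or> k = l \<or> lt l k"
    and trans: "\<And>j k l. \<lbrakk>lt j k; lt k l\<rbrakk> \<Longrightarrow> lt j l"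
    and nested: "\<And>k l. \<lbrakk>k \<in> G; l \<in> G; lt k l\<rbrakk> \<Longrightarrow> T l \<subseteq> T k"
      "\<And>k l. \<lbrakk>k \<in> G; l \<in> G; lt k l\<rbrakk> \<Longrightarrow> F k \<subseteq> F l"
    and M: "\<And>k. k \<in> G \<Longrightarrow> M k \<in> Obj C \<and> \<not> is_zero C (M k) \<and> M k \<in> T k"
      "\<And>k l. \<lbrakk>k \<in> G; l \<in> G; lt k l\<rbrakk> \<Longrightarrow> M k \<notin> T l"
    and A_def: "\<And>k. A k = Obj C \<inter> (\<Inter>j \<in> {j \<in> G. lt k j}. F j)"
    and Om_def: "\<And>k. Om k = torsion_free_part C (left_perp C (A k)) (A k) (M k)"
    and split: "\<And>k j. \<lbrakk>k \<in> G; j \<in> G; lt j k \<or> j = k\<rbrakk> \<Longrightarrow> all_split C (M k) (Om j)"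
  shows "k \<in> G \<Longrightarrow> Om k \<in> Obj C \<and> \<not> is_zero C (Om k)"
    and "\<lbrakk>k \<in> G; j \<in> G; lt j k\<rbrakk> \<Longrightarrow> Hom_vanishes C (Om k) (Om j)"
    and "\<lbrakk>k \<in> G; j \<in> G; lt j k \<or> j = k\<rbrakk> \<Longrightarrow> all_split C (Om k) (Om j)"
proof -
  \<comment> \<open>The last alternative covers a maximal \<open>k\<close>, where \<open>A k\<close>
    consists of all objects. Otherwise the torsion part lies in a single \<open>T l\<close>, which
    is more than membership in \<open>left_perp\<close> says.\<close>
  have seq: "\<exists>t i p f. short_exact C t i (M k) p f \<and> t \<in> left_perp C (A k) \<and> f \<in> A k \<and>
      ((\<exists>l \<in> G. lt k l \<and> t \<in> T l) \<or> f = M k \<and> A k = Obj C)" if k: "k \<in> G" for k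
  proof (cases "{j \<in> G. lt k j} = {}")
    case True
    then have A: "A k = Obj C" unfolding A_def True by simp
    obtain Z where Z: "is_zero C Z" using ex_zero by blast
    then have "Z \<in> left_perp C (A k)"
      using is_zero_ar_unique(2) A by (auto simp: left_perp_def is_zero_def intro!: Hom_vanishesI)
    then show ?thesis using zero_obj_short_exact[OF Z] M(1)[OF k] A by blast
  next
    case False
    define J where "J = {j \<in> G. lt k j}"
    have J: "j \<in> J \<longleftrightarrow> j \<in> G \<and> lt k j" for j by (simp add: J_def)
    have "\<exists>j \<in> J. \<exists>t i p f. short_exact C t i (M k) p f \<and> t \<in> T j \<and> f \<in> (\<Inter>j \<in> J. F j)"
    proof (rule chain_torsion_sequence[OF L])
      show "J \<noteq> {}" using False by (simp add: J_def)
      show "T i \<subseteq> T j \<or> F i \<subseteq> F j" if "i \<in> J" "j \<in> J" for i j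
        using total[of i j] nested(1)[of j i] nested(2)[of i j] that by (auto simp: J)
      show "torsion_pair C (T j) (F j)" if "j \<in> J" for j using tp that by (simp add: J)
      show "M k \<in> Obj C" using M(1)[OF k] by simp
    qed
    then obtain j t i p f where "j \<in> J"
      and s: "short_exact C t i (M k) p f" "t \<in> T j" "f \<in> (\<Inter>j \<in> J. F j)" by metis
    then have j: "j \<in> G" "lt k j" by (auto simp: J)
    have "f \<in> A k" using s(3) short_exactD(6)[OF s(1)] ar_objD(2) by (auto simp: A_def J_def)
    moreover have "t \<in> left_perp C (A k)"
      using torsion_pairD(1,5)[OF tp[OF j(1)]] s(2) j by (auto simp: A_def left_perp_def)
    ultimately show ?thesis using s j by blast
  qed
  have Om: "\<exists>t i p. short_exact C t i (M k) p (Om k) \<and> t \<in> left_perp C (A k) \<and> Om k \<in> A k" if k: "k \<in> G" for k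
  proof -
    have "\<exists>Z. Z \<in> A k \<and> (\<exists>X \<in> left_perp C (A k). \<exists>i p. short_exact C X i (M k) p Z)"
      using seq[OF k] by blast
    from someI_ex[OF this] show ?thesis unfolding Om_def torsion_free_part_def by blast
  qed
  show Om1: "Om k \<in> Obj C \<and> \<not> is_zero C (Om k)" if k: "k \<in> G" for k
  proof
    obtain t i p where s: "short_exact C t i (M k) p (Om k)" "t \<in> left_perp C (A k)" "Om k \<in> A k"
      using Om[OF k] by blast
    note e = short_exactD[OF s(1)]
    show "Om k \<in> Obj C" using s(3) by (simp add: A_def)
    show "\<not> is_zero C (Om k)"
    proof
      assume z: "is_zero C (Om k)"
      \<comment> \<open>\<open>Om k\<close> is a chosen representative, whose sequence may differ
        from the one in \<open>seq\<close>. If it is zero, no non-zero map leads from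
        \<open>M k\<close> into \<open>A k\<close>; this kills the torsion-free part
        \<open>f'\<close> from \<open>seq\<close> without any appeal to uniqueness.\<close>
      have van: "g = zr (M k) Y" if Y: "Y \<in> A k" and g: "ar g (M k) Y" for g Y
      proof -
        have "g \<star> i = zr t Y" using s(2) Y Hom_vanishesD[OF _ ar_comp[OF g e(5)]] by (auto simp: left_perp_def)
        from cokernel_desc[OF e(2) g this] obtain h where h: "ar h (Om k) Y" "h \<star> p = g" .
        then show ?thesis using is_zero_ar_unique(2)[OF z h(1)] comp_zero(2)[OF e(6)] ar_objD(2) by metis
      qed
      obtain t' i' p' f' where s': "short_exact C t' i' (M k) p' f'" "f' \<in> A k"
        and d: "(\<exists>l \<in> G. lt k l \<and> t' \<in> T l) \<or> f' = M k \<and> A k = Obj C" using seq[OF k] by blast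
      note e' = short_exactD[OF s'(1)]
      have fO: "f' \<in> Obj C" using s'(2) by (simp add: A_def)
      have "p' = zr (M k) f'" using van s'(2) e'(6) by blast
      then have "Ident C f' = zr f' f'" using epi_zeroD[OF e'(4) ar_id[OF fO]] comp_id(2)[OF e'(6)] by simp
      then have fz: "is_zero C f'" using fO is_zero_iff by simp
      from d show False
      proof
        assume "\<exists>l \<in> G. lt k l \<and> t' \<in> T l"
        then obtain l where l: "l \<in> G" "lt k l" "t' \<in> T l" by blast
        then have "M k \<in> T l" using short_exact_right_zero_iso[OF s'(1) fz] torsion_pairD(3)[OF tp[OF l(1)]]
          unfolding iso_closed_def by blast
        then show False using M(2) k l by blast
      next
        assume "f' = M k \<and> A k = Obj C"
        then show False using fz M(1)[OF k] by blast
      qed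
    qed
  qed
  have mono: "A j \<subseteq> A k" if "lt j k \<or> j = k" for j k using that trans by (auto simp: A_def)
  show "Hom_vanishes C (Om k) (Om j)" if kj: "k \<in> G" "j \<in> G" "lt j k" for k j
  proof (rule Hom_vanishesI)
    obtain t i p where s: "short_exact C t i (M k) p (Om k)" using Om[OF kj(1)] by blast
    note e = short_exactD[OF s]
    have "Om j \<in> F k" using Om[OF kj(2)] kj by (auto simp: A_def)
    then have hv: "Hom_vanishes C (M k) (Om j)" using torsion_pairD(5)[OF tp[OF kj(1)]] M(1)[OF kj(1)] by blast
    fix f assume f: "ar f (Om k) (Om j)"
    from Hom_vanishesD[OF hv ar_comp[OF f e(6)]] show "f = zr (Om k) (Om j)" by (rule epi_zeroD[OF e(4) f])
  qed (use Om1 kj in auto)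
  show "all_split C (Om k) (Om j)" if kj: "k \<in> G" "j \<in> G" "lt j k \<or> j = k" for k j
  proof -
    obtain t i p where s: "short_exact C t i (M k) p (Om k)" "t \<in> left_perp C (A k)" using Om[OF kj(1)] by blast
    have "Om j \<in> A k" using Om[OF kj(2)] mono[OF kj(3)] by blast
    then have "Hom_vanishes C t (Om j)" using s(2) by (auto simp: left_perp_def)
    then show ?thesis by (rule all_split_quotient[OF s(1) split[OF kj]])
  qed
qed

end

section \<open>The opposite category\<close>

definition op_cat :: "('o, 'm, 'k, 'x) lin_cat_scheme \<Rightarrow> ('o, 'm, 'k) lin_cat" where
  "op_cat C = \<lparr>Obj = Obj C, Hom = (\<lambda>X Y. Hom C Y X), Ident = Ident C, Comp = (\<lambda>g f. f \<cdot>\<^bsub>C\<^esub> g)\<rparr>"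

lemma op_cat_simps [simp]:
  "Obj (op_cat C) = Obj C" "Hom (op_cat C) X Y = Hom C Y X" "Ident (op_cat C) = Ident C"
  "g \<cdot>\<^bsub>op_cat C\<^esub> f = f \<cdot>\<^bsub>C\<^esub> g"
  by (simp_all add: op_cat_def)

lemma op_cat_is_iso: "is_iso (op_cat C) X Y f \<longleftrightarrow> is_iso C Y X f"
  by (auto simp: Defs.is_iso_def)

lemma op_cat_is_mono: "is_mono (op_cat C) X Y f \<longleftrightarrow> is_epi C Y X f"
  by (auto simp: is_mono_def is_epi_def)

lemma op_cat_is_epi: "is_epi (op_cat C) X Y f \<longleftrightarrow> is_mono C Y X f"
  by (auto simp: is_mono_def is_epi_def)

lemma op_cat_is_zero: "is_zero (op_cat C) Z \<longleftrightarrow> is_zero C Z"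
  by (auto simp: is_zero_def)

lemma op_cat_is_biproduct: "is_biproduct (op_cat C) A B P i1 i2 p1 p2 \<longleftrightarrow> is_biproduct C A B P p1 p2 i1 i2"
  by (auto simp: is_biproduct_def)

lemma op_cat_is_kernel: "is_kernel (op_cat C) N i X f Y \<longleftrightarrow> is_cokernel C Y f X i N"
  by (auto simp: is_kernel_def is_cokernel_def)

lemma op_cat_is_cokernel: "is_cokernel (op_cat C) X f Y p Q \<longleftrightarrow> is_kernel C Q p Y f X"
  by (auto simp: is_kernel_def is_cokernel_def)

lemma op_cat_short_exact: "short_exact (op_cat C) X i Y p Z \<longleftrightarrow> short_exact C Z p Y i X"
  by (auto simp: short_exact_def op_cat_is_kernel op_cat_is_cokernel)

lemma op_cat_Hom_vanishes: "Hom_vanishes (op_cat C) X Y \<longleftrightarrow> Hom_vanishes C Y X"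
  by (simp add: Hom_vanishes_def)

lemma op_cat_left_perp: "left_perp (op_cat C) S = right_perp C S"
  by (simp add: left_perp_def right_perp_def op_cat_Hom_vanishes)

text \<open>Reversing sequences makes the two choice predicates identical, so the chosen objects are
  equal and not merely isomorphic.\<close>

lemma op_cat_torsion_free_part: "torsion_free_part (op_cat C) F T M = torsion_part C T F M"
  unfolding torsion_free_part_def torsion_part_def op_cat_short_exact by metis

lemma op_cat_length_function: "length_function C L \<Longrightarrow> length_function (op_cat C) L"
  unfolding length_function_def op_cat_simps op_cat_short_exact op_cat_is_zero by (metis add.commute)

lemma (in linear_category) op_cat_iso_closed: "iso_closed (op_cat C) S \<longleftrightarrow> iso_closed C S"
proof -
  have "is_iso C Y X f \<Longrightarrow> \<exists>g. is_iso C X Y g" for X Y f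
    by (metis isoE isoI)
  then show ?thesis unfolding iso_closed_def op_cat_is_iso by metis
qed

lemma (in linear_category) op_cat_torsion_pair: "torsion_pair (op_cat C) F T \<longleftrightarrow> torsion_pair C T F"
  unfolding torsion_pair_def op_cat_iso_closed op_cat_short_exact op_cat_Hom_vanishes op_cat_simps by blast

context abelian_category
begin

lemma op_cat_abelian_category: "abelian_category K (op_cat C)"
proof (intro abelian_category.intro linear_category.intro linear_category_axioms.intro
    abelian_category_axioms.intro)
  show "field K" by (rule R.field_axioms)
  \<comment> \<open>Injections and projections change places, so the witnesses have to be
    permuted.\<close>
  show "\<exists>P i1 i2 p1 p2. is_biproduct (op_cat C) A B P i1 i2 p1 p2"
    if "A \<in> Obj (op_cat C)" "B \<in> Obj (op_cat C)" for A B
    using ex_biproduct[of A B] that unfolding op_cat_is_biproduct op_cat_simps by blast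
qed (use ex_zero ex_kernel ex_cokernel mono_is_kernel epi_is_cokernel
    in \<open>auto simp: op_cat_is_zero op_cat_is_kernel op_cat_is_cokernel op_cat_is_mono
      op_cat_is_epi Hom_module Ident_arr Comp_Ident_left Comp_Ident_right Comp_add_left Comp_add_right
      Comp_smult_left Comp_smult_right intro: Comp_arr Comp_assoc[symmetric]\<close>)

text \<open>A section completes to a biproduct, which contains a retraction. The converse is the
  same argument in the opposite category. This makes \<open>all_split\<close> self-dual.\<close>

lemma all_split_iff_retraction:
  "all_split C X Y \<longleftrightarrow>
    (\<forall>E i p. short_exact C Y i E p X \<longrightarrow> (\<exists>r \<in> arr C E Y. r \<star> i = Ident C Y))"
proof -
  interpret O: abelian_category K "op_cat C" by (rule op_cat_abelian_category)
  have "(\<exists>s \<in> arr C X E. p \<star> s = Ident C X) \<longleftrightarrow> (\<exists>r \<in> arr C E Y. r \<star> i = Ident C Y)"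
    if se: "short_exact C Y i E p X" for E i p
  proof -
    have YX: "X \<in> Obj C" "Y \<in> Obj C" using short_exactD(5,6)[OF se] ar_objD by auto
    show ?thesis
    proof
      assume "\<exists>s \<in> arr C X E. p \<star> s = Ident C X"
      then obtain s where "s \<in> arr C X E" "p \<star> s = Ident C X" by blast
      then obtain r where "is_biproduct C Y X E i s r p"
        using section_biproduct[OF se] short_exactD(5)[OF se] YX by (auto simp: arrow_def)
      then show "\<exists>r \<in> arr C E Y. r \<star> i = Ident C Y" unfolding is_biproduct_def by blast
    next
      have se': "short_exact (op_cat C) X p E i Y" using se by (simp add: op_cat_short_exact)
      assume "\<exists>r \<in> arr C E Y. r \<star> i = Ident C Y"
      then obtain r where "r \<in> arr C E Y" "r \<star> i = Ident C Y" by blast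
      then obtain s where "is_biproduct (op_cat C) X Y E p r s i"
        using O.section_biproduct[OF se'] short_exactD(5)[OF se] YX by (auto simp: arrow_def)
      then have "is_biproduct C X Y E s i p r" by (rule op_cat_is_biproduct[THEN iffD1])
      then show "\<exists>s \<in> arr C X E. p \<star> s = Ident C X" unfolding is_biproduct_def by blast
    qed
  qed
  then show ?thesis unfolding all_split_def by blast
qed

lemma op_cat_all_split:
  "all_split (op_cat C) X Y \<longleftrightarrow> all_split C Y X"
  unfolding all_split_iff_retraction[of Y X]
  unfolding all_split_def op_cat_short_exact op_cat_simps by blast

text \<open>Dual of \<open>torsion_memI\<close>, through which inclusions of torsion classes become
  reversed inclusions of torsion-free classes.\<close>

lemma torsion_free_memI:
  assumes "torsion_pair C T F" "Y \<in> Obj C" "\<And>X. X \<in> T \<Longrightarrow> Hom_vanishes C X Y"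
  shows "Y \<in> F"
proof -
  interpret O: abelian_category K "op_cat C" by (rule op_cat_abelian_category)
  show ?thesis
    by (rule O.torsion_memI) (use assms in \<open>auto simp: op_cat_torsion_pair op_cat_Hom_vanishes\<close>)
qed

end

theorem theorem4p9:
  fixes K :: "('k, 'r) ring_scheme"
    and C :: "('o, 'm, 'k, 'x) lin_cat_scheme"
    and G :: "'g::linorder set"
    and T F :: "'g \<Rightarrow> 'o set"
    and M :: "'g \<Rightarrow> 'o"
  assumes "abelian_length_category K C"
    and "nested_torsion_pairs C G T F"
    and "M \<in> Gr_obj C G"
  shows "(M \<in> M_dagger C G T F \<longrightarrow> pre_stratifying_system C G (frak_F C G F M)) \<and>
         (M \<in> N_dagger C G T F \<longrightarrow> pre_stratifying_system C G (frak_T C G T M))"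
proof -
  interpret abelian_length_category K C by (fact assms(1))
  interpret O: abelian_category K "op_cat C" by (rule op_cat_abelian_category)
  have L: "length_function C (comp_length C)" by (rule length_function_comp_length[OF Obj_finite_length])
  have tp: "torsion_pair C (T k) (F k)" if "k \<in> G" for k
    using assms(2) that unfolding nested_torsion_pairs_def by blast
  have T_anti: "T l \<subseteq> T k" if "k \<in> G" "l \<in> G" "k < l" for k l
    using assms(2) that unfolding nested_torsion_pairs_def by blast
  have F_mono: "F k \<subseteq> F l" if kl: "k \<in> G" "l \<in> G" "k < l" for k l
  proof
    fix Y assume Y: "Y \<in> F k"
    show "Y \<in> F l"
      by (rule torsion_free_memI[OF tp[OF kl(2)]])
        (use Y T_anti[OF kl] torsion_pairD(2,5)[OF tp[OF kl(1)]] in auto)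
  qed
  have MO: "M k \<in> Obj C" if "k \<in> G" for k using assms(3) that by (auto simp: Gr_obj_def)
  show ?thesis
  proof (intro conjI impI)
    assume *: "M \<in> M_dagger C G T F"
    \<comment> \<open>The family is not the zero object, which leaves the second alternative in
      \<open>M_cat\<close>.\<close>
    then have dag: "\<forall>k \<in> G. \<not> is_zero C (M k) \<and> M k \<in> T k \<and> (\<forall>j \<in> G. j > k \<longrightarrow> M k \<notin> T j)"
      unfolding M_dagger_def M_cat_def mem_Collect_eq by argo
    have M: "M k \<in> Obj C \<and> \<not> is_zero C (M k) \<and> M k \<in> T k" if "k \<in> G" for k
      using dag that MO by (simp)
    have M': "M k \<notin> T l" if "k \<in> G" "l \<in> G" "k < l" for k l
      using dag that by simp
    have split: "all_split C (M k) (frak_F C G F M j)" if "k \<in> G" "j \<in> G" "j < k \<or> j = k" for k j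
      using * that Ext1_vanishes_imp_all_split unfolding M_dagger_def by (auto simp: le_less)
    have tot: "k < l \<or> k = l \<or> l < k" for k l :: 'g by auto
    note main = torsion_free_quotients[where lt = "\<lambda>k l. k < l" and A = "F_above C G F"
        and Om = "frak_F C G F M" and M = M and G = G and T = T and F = F,
        OF L tp tot less_trans T_anti F_mono M M' F_above_def frak_F_def split]
    show "pre_stratifying_system C G (frak_F C G F M)"
      unfolding pre_stratifying_system_def
      using main by (auto simp: le_less intro: all_split_imp_Ext1_vanishes)
  next
    assume *: "M \<in> N_dagger C G T F"
    then have dag: "\<forall>k \<in> G. \<not> is_zero C (M k) \<and> M k \<in> F k \<and> (\<forall>j \<in> G. j < k \<longrightarrow> M k \<notin> F j)"
      unfolding N_dagger_def N_cat_def mem_Collect_eq by argo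
    have M: "M k \<in> Obj (op_cat C) \<and> \<not> is_zero (op_cat C) (M k) \<and> M k \<in> F k" if "k \<in> G" for k
      using dag that MO by (simp add: op_cat_is_zero)
    have M': "M k \<notin> F l" if "k \<in> G" "l \<in> G" "l < k" for k l
      using dag that by simp
    \<comment> \<open>In the opposite category the arguments of Ext are exchanged, so the condition
      on \<open>j\<close> and \<open>k\<close> appears with the order reversed.\<close>
    have split: "all_split (op_cat C) (M k) (frak_T C G T M j)" if "k \<in> G" "j \<in> G" "k < j \<or> j = k" for k j
      using * that Ext1_vanishes_imp_all_split
      unfolding N_dagger_def op_cat_all_split by (auto simp: le_less)
    have tot: "l < k \<or> k = l \<or> k < l" for k l :: 'g by auto
    have trans: "k < j \<Longrightarrow> l < k \<Longrightarrow> l < j" for j k l :: 'g by auto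
    have tp': "torsion_pair (op_cat C) (F k) (T k)" if "k \<in> G" for k
      using tp[OF that] by (simp add: op_cat_torsion_pair)
    have A: "T_below C G T k = Obj (op_cat C) \<inter> (\<Inter>j \<in> {j \<in> G. j < k}. T j)" for k
      by (simp add: T_below_def)
    have Om: "frak_T C G T M k =
        torsion_free_part (op_cat C) (left_perp (op_cat C) (T_below C G T k)) (T_below C G T k) (M k)" for k
      by (simp add: frak_T_def op_cat_torsion_free_part op_cat_left_perp)
    \<comment> \<open>Torsion and torsion-free classes swap roles; unfolding then translates the
      conclusions back to \<open>C\<close>.\<close>
    note main = O.torsion_free_quotients[where lt = "\<lambda>k l. l < k" and A = "T_below C G T"
        and Om = "frak_T C G T M" and M = M and G = G and T = F and F = T,
        OF op_cat_length_function[OF L] tp' tot trans F_mono T_anti M M' A Om split,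
        unfolded op_cat_simps op_cat_is_zero op_cat_Hom_vanishes op_cat_all_split]
    show "pre_stratifying_system C G (frak_T C G T M)"
      unfolding pre_stratifying_system_def
      using main by (auto simp: le_less intro: all_split_imp_Ext1_vanishes)
  qed
qed

end
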